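(* Let $X$ be a dendrite and let $g$ be an arbitrary homeomorphism of $X$. Let $D(g)$ be the union of the sets $O(I)$ over all austro-boreal arcs $I$ for $g$, and let $K(g)=X\setminus D(g)$. Then the decomposition $X=D(g)\sqcup K(g)$ has the following properties. (i) $D(g)$ is a (possibly empty) open $g$-invariant set on which $g$ acts properly discontinuously. In particular, $K(g)$ is a non-empty compact $g$-invariant set. (ii) Every connected component of $D(g)$ is of the form $O(I)$ for some austro-boreal arc $I$, and $g$ acts co-compactly on each $O(I)$. (iii) $K(g)$ is a disjoint union of sub-dendrites of $X$. Moreover, $g$ preserves each such sub-dendrite and has a connected fixed-point set in each.
   Context: A continuum is a non-empty connected compact metrisable space. A dendrite is a locally connected continuum containing no simple closed curve (a single point is allowed). A sub-dendrite of $X$ is a non-empty closed connected subset of $X$ (it is automatically a dendrite). Any two points $x,y$ of a dendrite $X$ are the extremities of a unique arc, denoted $[x,y]$. $\mathrm{Fix}(g)$ denotes the set of $g$-fixed points in $X$. An arc $I=[x,y]\subseteq X$ with $x\neq y$ is austro-boreal for $g$ if $\mathrm{Fix}(g)\cap[x,y]=\{x,y\}$. For such an arc, $O(I)\subseteq X$ denotes the connected component of $X\setminus\{x,y\}$ that contains $I\setminus\{x,y\}$. "Acts properly discontinuously" and "acts co-compactly" refer to the action of the cyclic group generated by $g$ (properly discontinuously on a locally compact space $D$: for each compact $C\subseteq D$, only finitely many $n\in\mathbf{Z}$ satisfy $g^nC\cap C\neq\varnothing$; co-compactly on $O$: there is a compact $C\subseteq O$ with $\bigcup_{n\in\mathbf{Z}}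 g^nC=O$). *)

theory Defs
  imports "HOL-Analysis.Analysis"
begin

text \<open>
  Spaces are subsets of an ambient metric space, always taken with the subspace topology. The metric
  only serves to express metrisability: every notion below is topological.
\<close>

definition continuum :: "'a::metric_space set \<Rightarrow> bool" where
  "continuum X \<longleftrightarrow> X \<noteq> {} \<and> compact X \<and> connected X"

definition dendrite :: "'a::metric_space set \<Rightarrow> bool" where
  "dendrite X \<longleftrightarrow> continuum X \<and> locally connected X \<and>
     \<not> (\<exists>c. simple_path c \<and> pathfinish c = pathstart c \<and> path_image c \<subseteq> X)"

definition sub_dendrite :: "'a::metric_space set \<Rightarrow> 'a set \<Rightarrow> bool" where
  "sub_dendrite X Y \<longleftrightarrow> Y \<noteq> {} \<and> closedin (top_of_set X) Y \<and> connected Y"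

definition arc_between :: "'a::metric_space set \<Rightarrow> 'a \<Rightarrow> 'a \<Rightarrow> 'a set \<Rightarrow> bool" where
  "arc_between X x y I \<longleftrightarrow>
     I \<subseteq> X \<and> (\<exists>p. arc p \<and> path_image p = I \<and> pathstart p = x \<and> pathfinish p = y)"

definition Fix :: "'a::metric_space set \<Rightarrow> ('a \<Rightarrow> 'a) \<Rightarrow> 'a set" where
  "Fix X g = {x \<in> X. g x = x}"

definition austro_boreal ::
    "'a::metric_space set \<Rightarrow> ('a \<Rightarrow> 'a) \<Rightarrow> 'a \<Rightarrow> 'a \<Rightarrow> 'a set \<Rightarrow> bool" where
  "austro_boreal X g x y I \<longleftrightarrow> x \<noteq> y \<and> arc_between X x y I \<and> Fix X g \<inter> I = {x, y}"

text \<open>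
  The set \<open>O(I)\<close> for an arc \<open>I\<close> with extremities \<open>x\<close> and \<open>y\<close>. The description is proper because
  \<open>I - {x, y}\<close> is then a non-empty connected subset of \<open>X - {x, y}\<close>.
\<close>

definition O_arc :: "'a::metric_space set \<Rightarrow> 'a \<Rightarrow> 'a \<Rightarrow> 'a set \<Rightarrow> 'a set" where
  "O_arc X x y I = (THE U. U \<in> components (X - {x, y}) \<and> I - {x, y} \<subseteq> U)"

definition D_set :: "'a::metric_space set \<Rightarrow> ('a \<Rightarrow> 'a) \<Rightarrow> 'a set" where
  "D_set X g = \<Union> {O_arc X x y I | x y I. austro_boreal X g x y I}"

definition K_set :: "'a::metric_space set \<Rightarrow> ('a \<Rightarrow> 'a) \<Rightarrow> 'a set" where
  "K_set X g = X - D_set X g"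

text \<open>The integer power \<open>g\<^sup>n\<close> of a bijection \<open>g\<close> of \<open>X\<close>; only meaningful on points of \<open>X\<close>.\<close>

definition int_iter :: "'a set \<Rightarrow> ('a \<Rightarrow> 'a) \<Rightarrow> int \<Rightarrow> 'a \<Rightarrow> 'a" where
  "int_iter X g n =
     (if 0 \<le> n then g ^^ nat n else inv_into X g ^^ nat (- n))"

definition acts_properly_discontinuously ::
    "'a::metric_space set \<Rightarrow> ('a \<Rightarrow> 'a) \<Rightarrow> 'a set \<Rightarrow> bool" where
  "acts_properly_discontinuously X g D \<longleftrightarrow>
     (\<forall>C. compact C \<and> C \<subseteq> D \<longrightarrow> finite {n. int_iter X g n ` C \<inter> C \<noteq> {}})"

definition acts_cocompactly ::
    "'a::metric_space set \<Rightarrow> ('a \<Rightarrow> 'a) \<Rightarrow> 'a set \<Rightarrow> bool" where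
  "acts_cocompactly X g U \<longleftrightarrow>
     (\<exists>C. compact C \<and> C \<subseteq> U \<and> (\<Union>n. int_iter X g n ` C) = U)"

end

theory Submission
  imports Defs
begin

text \<open>
  Everything rests on one property of a dendrite \<open>X\<close>: a connected subset that contains the ends of
  an arc contains the whole arc (\<open>dendrite_arc_subset_connected\<close>). For otherwise it misses a point
  \<open>z\<close> of the arc, so that the ends lie in one component of \<open>X - {z}\<close>; a path in that component which
  leaves the arc before \<open>z\<close> and returns to it after \<open>z\<close> closes up to a simple closed curve. The paths
  exist because locally connected compact metric spaces are locally path-connected
  (\<open>compact_locally_connected_imp_locally_path_connected\<close>). Arcs are therefore unique, and every
  interior point of an arc separates its ends.

  Let \<open>I\<close> be austro-boreal for \<open>g\<close>, with ends \<open>x\<close> and \<open>y\<close>. By uniqueness \<open>g\<close> maps \<open>I\<close> to itself, and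
  it acts on its interior as a fixed-point-free homeomorphism of an open interval. The orbit of an
  interior point is thus a sequence \<open>z\<^sub>n\<close> that tends to one end, say \<open>y\<close>, in the future and to the
  other in the past. Let \<open>B\<^sub>n\<close> be the component of \<open>X - {z\<^sub>n}\<close> that contains \<open>y\<close>. These open sets
  decrease and \<open>g\<close> maps \<open>B\<^sub>n\<close> to \<open>B\<^sub>n\<^sub>+\<^sub>1\<close>. A point of \<open>O(I)\<close> is joined to the interior of \<open>I\<close> by a path
  that avoids both ends, hence avoids \<open>z\<^sub>n\<close> for all large \<open>\<bar>n\<bar>\<close>; so it lies in \<open>B\<^sub>-\<^sub>n\<close> and outside the
  closure of \<open>B\<^sub>n\<close> for large \<open>n\<close>. A point outside \<open>O(I)\<close> lies in all of the \<open>B\<^sub>n\<close> or in none.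
  Consequently the closure of \<open>B\<^sub>0\<close> minus \<open>B\<^sub>1\<close> is a compact subset of \<open>O(I)\<close> whose translates cover
  \<open>O(I)\<close>, and the sets \<open>B\<^sub>-\<^sub>n\<close> minus the closure of \<open>B\<^sub>n\<close> are an open exhaustion of \<open>O(I)\<close> whose members
  are moved off themselves by all but finitely many powers of \<open>g\<close>. This gives both dynamical claims
  (\<open>region_cocompact\<close>, \<open>region_properly_discontinuous\<close>) and shows that \<open>O(I)\<close> has no fixed point.

  The boundary of \<open>O(I)\<close> consists of fixed points, so a connected set that meets \<open>O(I)\<close> without
  being contained in it contains a fixed point (\<open>zone_escape\<close>). Two sets \<open>O(I)\<close> and \<open>O(J)\<close> are
  fixed-point-free and connected, so they are equal or disjoint. Being open, they are the components
  of \<open>D(g)\<close>.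

  A homeomorphism of a dendrite has a fixed point (\<open>dendrite_homeomorphism_fixed_point\<close>). A path to
  it from a point of a component \<open>Y\<close> of \<open>K(g)\<close>, followed until it first meets a fixed point, cannot enter
  any \<open>O(I)\<close>, so it stays in \<open>K(g)\<close> and therefore in \<open>Y\<close>. Hence \<open>Y\<close> contains a fixed point and is
  preserved by \<open>g\<close>. Two fixed points in \<open>Y\<close> are joined by an arc inside \<open>Y\<close>; a gap in the fixed-point
  set along this arc would be an austro-boreal arc, whose interior lies in \<open>D(g)\<close>. So the arc consists
  of fixed points, and the fixed-point set in \<open>Y\<close> is connected.
\<close>

section \<open>Local path-connectedness of Peano continua\<close>

text \<open>
  Broken lines in the ambient vector space, with vertices in \<open>S\<close> and edges shorter than \<open>d\<close>; the
  edges themselves may leave \<open>S\<close>. The inductive form lets a broken line be refined edge by edge without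
  keeping track of a subdivision of the parameter interval.
\<close>

inductive polygon :: "real \<Rightarrow> 'b::real_normed_vector set \<Rightarrow> (real \<Rightarrow> 'b) \<Rightarrow> bool"
  for d S where
  segment: "u \<in> S \<Longrightarrow> v \<in> S \<Longrightarrow> dist u v < d \<Longrightarrow> polygon d S (linepath u v)"
| concat: "polygon d S p \<Longrightarrow> polygon d S q \<Longrightarrow> pathfinish p = pathstart q \<Longrightarrow>
    polygon d S (p +++ q)"

lemma polygon_path: "polygon d S p \<Longrightarrow> path p"
  by (induction rule: polygon.induct) auto

lemma polygon_mono: "polygon d S p \<Longrightarrow> S \<subseteq> T \<Longrightarrow> polygon d T p"
  by (induction rule: polygon.induct) (auto intro: polygon.intros)

lemma dist_linepath_le:
  assumes "t \<in> {0..1::real}"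
  shows "dist u (linepath u v t) \<le> dist u v"
proof -
  have "linepath u v t - u = t *\<^sub>R (v - u)"
    by (simp add: linepath_def algebra_simps)
  then have "dist u (linepath u v t) = t * dist u v"
    using assms by (simp add: dist_norm norm_minus_commute[of u])
  also have "\<dots> \<le> 1 * dist u v"
    using assms by (intro mult_right_mono) auto
  finally show ?thesis by simp
qed

lemma polygon_near:
  assumes "polygon d S p" "t \<in> {0..1}"
  shows "\<exists>s\<in>S. dist s (p t) < d"
  using assms
proof (induction arbitrary: t rule: polygon.induct)
  case (segment u v)
  then show ?case
    using dist_linepath_le[of t u v] by (intro bexI[of _ u]) auto
next
  case (concat p q)
  show ?case
  proof (cases "t \<le> 1/2")
    case True
    then show ?thesis
      using concat.IH(1)[of "2 * t"] concat.prems by (auto simp: joinpaths_def)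
  next
    case False
    then show ?thesis
      using concat.IH(2)[of "2 * t - 1"] concat.prems by (auto simp: joinpaths_def)
  qed
qed

text \<open>
  Being joined by a broken line with vertices in \<open>C\<close> is an equivalence relation that relates any
  two points of \<open>C\<close> at distance below \<open>d\<close>, so its classes are open in \<open>C\<close>.
\<close>

lemma connected_imp_polygon:
  fixes C :: "'b::real_normed_vector set"
  assumes "connected C" "a \<in> C" "b \<in> C" "0 < d"
  obtains p where "polygon d C p" "pathstart p = a" "pathfinish p = b"
proof -
  define R where "R = (\<lambda>x y. \<exists>p. polygon d C p \<and> pathstart p = x \<and> pathfinish p = y)"
  have step: "R x y" if "x \<in> C" "y \<in> C" "dist x y < d" for x y
    unfolding R_def using that
    by (intro exI[of _ "linepath x y"]) (auto intro: polygon.segment)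
  have trans: "R x z" if "R x y" "R y z" for x y z
    using that unfolding R_def by (metis polygon.concat pathfinish_join pathstart_join)
  have "R a b \<and> R b a"
  proof (rule connected_equivalence_relation[OF assms(1-3)])
    fix x assume "x \<in> C"
    then show "\<exists>T. openin (top_of_set C) T \<and> x \<in> T \<and> (\<forall>y\<in>T. R x y \<and> R y x)"
      using \<open>0 < d\<close>
      by (intro exI[of _ "C \<inter> ball x d"])
        (auto intro!: step simp: dist_commute openin_open_Int)
  qed (use trans in blast)+
  then show thesis
    using that unfolding R_def by blast
qed

text \<open>
  The inductive step of the construction of paths: each edge \<open>[u, v]\<close> is replaced by a finer broken
  line with vertices in a small connected set \<open>C\<close> that contains \<open>u\<close> and \<open>v\<close>. The bound \<open>3 * e\<close> adds up
  the length of the edge, the radius of \<open>C\<close> and the distance to a vertex of the finer line.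
\<close>

lemma refine_polygon:
  fixes S :: "'b::real_normed_vector set"
  assumes small: "\<And>u v. u \<in> S \<Longrightarrow> v \<in> S \<Longrightarrow> dist u v < d \<Longrightarrow>
                    \<exists>C. connected C \<and> C \<subseteq> S \<and> u \<in> C \<and> v \<in> C \<and> C \<subseteq> cball u e"
    and d: "d \<le> e" and d': "0 < d'" "d' \<le> e"
    and p: "polygon d S p"
  shows "\<exists>q. polygon d' S q \<and> pathstart q = pathstart p \<and> pathfinish q = pathfinish p \<and>
             (\<forall>t\<in>{0..1}. dist (p t) (q t) \<le> 3 * e)"
  using p
proof (induction rule: polygon.induct)
  case (segment u v)
  obtain C where C: "connected C" "C \<subseteq> S" "u \<in> C" "v \<in> C" "C \<subseteq> cball u e"
    using small[OF segment] by blast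
  obtain q where q: "polygon d' C q" "pathstart q = u" "pathfinish q = v"
    using connected_imp_polygon C d' by metis
  have "dist (linepath u v t) (q t) \<le> 3 * e" if t: "t \<in> {0..1}" for t
  proof -
    obtain s where "s \<in> C" "dist s (q t) < d'"
      using polygon_near[OF q(1) t] by blast
    moreover have "dist u s \<le> e"
      using \<open>s \<in> C\<close> C by auto
    moreover have "dist u (linepath u v t) \<le> e"
      using dist_linepath_le[OF t, of u v] segment d by simp
    moreover have "dist (linepath u v t) (q t) \<le> dist u (linepath u v t) + dist u s + dist s (q t)"
      using dist_triangle3[of "linepath u v t" "q t" u] dist_triangle[of u "q t" s] by simp
    ultimately show ?thesis
      using d' by linarith
  qed
  then show ?case
    using q C by (intro exI[of _ q]) (auto intro: polygon_mono)
next
  case (concat p1 p2)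
  obtain q1 where q1: "polygon d' S q1" "pathstart q1 = pathstart p1" "pathfinish q1 = pathfinish p1"
             "\<forall>t\<in>{0..1}. dist (p1 t) (q1 t) \<le> 3 * e"
    using concat.IH by blast
  obtain q2 where q2: "polygon d' S q2" "pathstart q2 = pathstart p2" "pathfinish q2 = pathfinish p2"
             "\<forall>t\<in>{0..1}. dist (p2 t) (q2 t) \<le> 3 * e"
    using concat.IH by blast
  have "dist ((p1 +++ p2) t) ((q1 +++ q2) t) \<le> 3 * e" if "t \<in> {0..1}" for t
    using q1(4) q2(4) that by (auto simp: joinpaths_def)
  then show ?case
    using q1 q2 concat.hyps by (intro exI[of _ "q1 +++ q2"]) (auto intro: polygon.concat)
qed

text \<open>
  The connected neighbourhoods given by local connectedness form an open cover; any Lebesgue number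
  of it that is at most \<open>e\<close> serves as \<open>d\<close>.
\<close>

lemma compact_uniformly_locally_connected:
  fixes S :: "'b::metric_space set"
  assumes "compact S" "locally connected S" "0 < e"
  obtains d where "0 < d" "d \<le> e"
    "\<And>u v. u \<in> S \<Longrightarrow> v \<in> S \<Longrightarrow> dist u v < d \<Longrightarrow>
        \<exists>C. connected C \<and> C \<subseteq> S \<and> u \<in> C \<and> v \<in> C \<and> C \<subseteq> cball u e"
proof -
  have "\<exists>U. open U \<and> x \<in> U \<and> connected (S \<inter> U) \<and> S \<inter> U \<subseteq> ball x (e/2)" if "x \<in> S" for x
  proof -
    have "openin (top_of_set S) (S \<inter> ball x (e/2))" "x \<in> S \<inter> ball x (e/2)"
      using that \<open>0 < e\<close> by (auto simp: openin_open_Int)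
    then obtain V where "openin (top_of_set S) V" "connected V" "x \<in> V" "V \<subseteq> S \<inter> ball x (e/2)"
      using \<open>locally connected S\<close> unfolding locally_connected by metis
    then show ?thesis
      by (auto simp: openin_open)
  qed
  then obtain U where U: "\<And>x. x \<in> S \<Longrightarrow> open (U x) \<and> x \<in> U x \<and> connected (S \<inter> U x) \<and> S \<inter> U x \<subseteq> ball x (e/2)"
    by metis
  obtain d where d: "0 < d" "\<And>x. x \<in> S \<Longrightarrow> \<exists>G \<in> U ` S. ball x d \<subseteq> G"
  proof (rule Heine_Borel_lemma[OF \<open>compact S\<close>, of "U ` S"])
    show "S \<subseteq> \<Union> (U ` S)" "\<And>G. G \<in> U ` S \<Longrightarrow> open G"
      using U by auto
  qed blast
  show thesis
  proof (rule that[of "min d e"])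
    fix u v assume uv: "u \<in> S" "v \<in> S" "dist u v < min d e"
    obtain x where x: "x \<in> S" "ball u d \<subseteq> U x"
      using d(2)[OF \<open>u \<in> S\<close>] by blast
    have "u \<in> S \<inter> U x" "v \<in> S \<inter> U x"
      using uv x d by auto
    moreover have "S \<inter> U x \<subseteq> cball u e"
    proof
      fix w assume "w \<in> S \<inter> U x"
      then have "dist x w < e/2" "dist x u < e/2"
        using U[OF x(1)] \<open>u \<in> S \<inter> U x\<close> by auto
      then show "w \<in> cball u e"
        using dist_triangle3[of u w x] by simp
    qed
    ultimately show "\<exists>C. connected C \<and> C \<subseteq> S \<and> u \<in> C \<and> v \<in> C \<and> C \<subseteq> cball u e"
      using U[OF x(1)] by (intro exI[of _ "S \<inter> U x"]) auto
  qed (use d \<open>0 < e\<close> in auto)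
qed

text \<open>
  Successive refinement with scales \<open>e / 2 ^ n\<close> gives a uniformly Cauchy sequence of broken lines.
  Its limit is a path, and it runs inside \<open>S\<close> because the vertices, which lie in the closed set \<open>S\<close>,
  become dense along the lines. The factor 7 is one for the first edge and \<open>3 * (1 + 1/2 + 1/4 + \<dots>)\<close>
  for the refinements.
\<close>

lemma short_path_in_compact_locally_connected:
  fixes S :: "'b::{complete_space,real_normed_vector} set"
  assumes "compact S" "locally connected S" "0 < e"
  obtains d where "0 < d"
    "\<And>x y. x \<in> S \<Longrightarrow> y \<in> S \<Longrightarrow> dist x y < d \<Longrightarrow>
        \<exists>p. path p \<and> path_image p \<subseteq> S \<inter> cball x (7 * e) \<and> pathstart p = x \<and> pathfinish p = y"
proof -
  have "\<forall>r. \<exists>d. 0 < r \<longrightarrow> 0 < d \<and> d \<le> r \<and> (\<forall>u v. u \<in> S \<longrightarrow> v \<in> S \<longrightarrow> dist u v < d \<longrightarrow>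
        (\<exists>C. connected C \<and> C \<subseteq> S \<and> u \<in> C \<and> v \<in> C \<and> C \<subseteq> cball u r))"
    using compact_uniformly_locally_connected[OF assms(1,2)] by metis
  then obtain \<delta> where \<delta>: "\<And>r. 0 < r \<Longrightarrow> 0 < \<delta> r \<and> \<delta> r \<le> r"
    and \<delta>C: "\<And>r u v. 0 < r \<Longrightarrow> u \<in> S \<Longrightarrow> v \<in> S \<Longrightarrow> dist u v < \<delta> r \<Longrightarrow>
        \<exists>C. connected C \<and> C \<subseteq> S \<and> u \<in> C \<and> v \<in> C \<and> C \<subseteq> cball u r"
    by metis
  define r where "r n = e / 2 ^ n" for n :: nat
  have r: "0 < r n" "r (Suc n) = r n / 2" for n
    using \<open>0 < e\<close> by (auto simp: r_def)
  have r0: "r \<longlonglongrightarrow> 0"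
    unfolding r_def by (rule LIMSEQ_divide_realpow_zero) simp
  have "\<exists>l. path l \<and> path_image l \<subseteq> S \<inter> cball x (7 * e) \<and> pathstart l = x \<and> pathfinish l = y"
    if xy: "x \<in> S" "y \<in> S" "dist x y < \<delta> e" for x y
  proof -
    define P where "P n p \<longleftrightarrow> polygon (\<delta> (r n)) S p \<and> pathstart p = x \<and> pathfinish p = y \<and>
                      (n = 0 \<longrightarrow> p = linepath x y)" for n p
    define Q where "Q n p q \<longleftrightarrow> (\<forall>t\<in>{0..1}. dist (p t) (q t) \<le> 3 * r n)"
      for n and p q :: "real \<Rightarrow> 'b"
    have P0: "\<exists>p. P 0 p"
      unfolding P_def using xy by (auto intro: polygon.segment simp: r_def)
    have PS: "\<exists>q. P (Suc n) q \<and> Q n p q" if "P n p" for p n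
    proof -
      have "\<exists>q. polygon (\<delta> (r (Suc n))) S q \<and> pathstart q = pathstart p \<and> pathfinish q = pathfinish p \<and>
             (\<forall>t\<in>{0..1}. dist (p t) (q t) \<le> 3 * r n)"
      proof (rule refine_polygon)
        show "polygon (\<delta> (r n)) S p"
          using that by (simp add: P_def)
        show "\<delta> (r n) \<le> r n" "0 < \<delta> (r (Suc n))"
          using \<delta>[OF r(1)] by auto
        have "\<delta> (r (Suc n)) \<le> r (Suc n)"
          using \<delta>[OF r(1)] by auto
        then show "\<delta> (r (Suc n)) \<le> r n"
          using r(2)[of n] r(1)[of n] by linarith
      qed (rule \<delta>C[OF r(1)])
      then show ?thesis
        using that by (auto simp: P_def Q_def)
    qed
    obtain p where "\<forall>n. P n (p n) \<and> Q n (p n) (p (Suc n))"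
      using dependent_nat_choice[of P Q, OF P0 PS] by blast
    then have p: "\<And>n. P n (p n)" and pS: "\<And>n t. t \<in> {0..1} \<Longrightarrow> dist (p n t) (p (Suc n) t) \<le> 3 * r n"
      unfolding Q_def by auto
    have tail: "dist (p n t) (p (n + k) t) \<le> 6 * r n - 6 * r (n + k)" if "t \<in> {0..1}" for n k t
    proof (induction k)
      case (Suc k)
      then show ?case
        using pS[OF that, of "n + k"] r(2)[of "n + k"]
          dist_triangle[of "p n t" "p (n + Suc k) t" "p (n + k) t"]
        by (simp del: power_Suc) 
    qed auto
    have tail': "dist (p n t) (p m t) < 6 * r n" if "t \<in> {0..1}" "n \<le> m" for n m t
      using tail[OF that(1), of n "m - n"] that r(1)[of m] by auto
    have "uniformly_Cauchy_on {0..1} p"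
    proof (rule uniformly_Cauchy_onI')
      fix \<epsilon> :: real assume "0 < \<epsilon>"
      then have "\<forall>\<^sub>F n in sequentially. r n < \<epsilon> / 6"
        using order_tendstoD(2)[OF r0, of "\<epsilon> / 6"] by simp
      then obtain N where N: "\<And>n. n \<ge> N \<Longrightarrow> 6 * r n < \<epsilon>"
        by (force simp: eventually_sequentially)
      show "\<exists>M. \<forall>t\<in>{0..1}. \<forall>m\<ge>M. \<forall>n>m. dist (p m t) (p n t) < \<epsilon>"
      proof (intro exI[of _ N] ballI allI impI)
        fix t m n assume "t \<in> {0..1::real}" "N \<le> m" "m < n"
        then show "dist (p m t) (p n t) < \<epsilon>"
          using tail'[of t m n] N[of m] by auto
      qed
    qed
    then obtain l where l: "uniform_limit {0..1} p l sequentially"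
      using Cauchy_uniformly_convergent uniformly_convergent_on_def by blast
    have lt: "(\<lambda>n. p n t) \<longlonglongrightarrow> l t" if "t \<in> {0..1}" for t
      using tendsto_uniform_limitI[OF l that] .
    have "continuous_on {0..1} l"
    proof (rule uniform_limit_theorem[OF _ l])
      have "continuous_on {0..1} (p n)" for n
        using p[of n] polygon_path by (auto simp: P_def path_def)
      then show "\<forall>\<^sub>F n in sequentially. continuous_on {0..1} (p n)"
        by simp
    qed simp
    then have "path l"
      by (simp add: path_def)
    have ends: "l 0 = x" "l 1 = y"
      using lt[of 0] lt[of 1] p by (auto simp: P_def pathstart_def pathfinish_def LIMSEQ_const_iff)
    have "l t \<in> S \<inter> cball x (7 * e)" if t: "t \<in> {0..1}" for t
    proof
      have "\<exists>s\<in>S. dist s (p n t) < \<delta> (r n)" for n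
        using polygon_near[OF _ t] p[of n] by (auto simp: P_def)
      then obtain s where s: "\<And>n. s n \<in> S" "\<And>n. dist (s n) (p n t) < \<delta> (r n)"
        by metis
      have near: "dist (s n) (p n t) \<le> r n" for n
        using s(2)[of n] \<delta>[OF r(1)[of n]] by linarith
      have "(\<lambda>n. r n + dist (p n t) (l t)) \<longlonglongrightarrow> 0 + 0"
        by (intro tendsto_add r0) (use lt[OF t] in \<open>simp add: tendsto_dist_iff[symmetric]\<close>)
      then have "(\<lambda>n. dist (s n) (l t)) \<longlonglongrightarrow> 0"
      proof (rule metric_tendsto_imp_tendsto)
        have "dist (s n) (l t) \<le> r n + dist (p n t) (l t)" for n
          using near[of n] dist_triangle[of "s n" "l t" "p n t"] by linarith
        then show "\<forall>\<^sub>F n in sequentially. dist (dist (s n) (l t)) 0 \<le> dist (r n + dist (p n t) (l t)) (0 + 0)"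
          using r(1) by (intro always_eventually allI) (simp add: dist_real_def add_nonneg_nonneg less_imp_le)
      qed
      then have "s \<longlonglongrightarrow> l t"
        by (simp add: tendsto_dist_iff[symmetric])
      then show "l t \<in> S"
        using s compact_imp_closed[OF \<open>compact S\<close>] closed_sequentially by blast
      have "p 0 t = linepath x y t"
        using p[of 0] by (simp add: P_def)
      then have "dist x (p 0 t) \<le> e"
        using dist_linepath_le[OF t, of x y] xy \<delta>[OF \<open>0 < e\<close>] by simp
      moreover have "dist (p 0 t) (l t) \<le> 6 * e"
      proof (rule Lim_bounded[OF tendsto_dist[OF tendsto_const lt[OF t]]])
        show "\<forall>n\<ge>0. dist (p 0 t) (p n t) \<le> 6 * e"
          using tail'[OF t, of 0] by (auto simp: r_def intro: less_imp_le)
      qed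
      ultimately show "l t \<in> cball x (7 * e)"
        using dist_triangle[of x "l t" "p 0 t"] by simp
    qed
    then show ?thesis
      using \<open>path l\<close> ends by (intro exI[of _ l]) (auto simp: path_image_def pathstart_def pathfinish_def)
  qed
  then show thesis
    using that \<delta>[OF \<open>0 < e\<close>] by blast
qed

lemma compact_locally_connected_imp_locally_path_connected_banach:
  fixes S :: "'b::{complete_space,real_normed_vector} set"
  assumes "compact S" "locally connected S"
  shows "locally path_connected S"
  unfolding locally_path_connected_im_kleinen
proof (intro allI impI, elim conjE)
  fix V x assume V: "openin (top_of_set S) V" "x \<in> V"
  then obtain \<epsilon> where \<epsilon>: "0 < \<epsilon>" "ball x \<epsilon> \<inter> S \<subseteq> V" and "x \<in> S"
    by (metis openin_contains_ball subsetD openin_imp_subset)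
  obtain d where d: "0 < d"
    "\<And>x y. x \<in> S \<Longrightarrow> y \<in> S \<Longrightarrow> dist x y < d \<Longrightarrow>
        \<exists>p. path p \<and> path_image p \<subseteq> S \<inter> cball x (7 * (\<epsilon>/8)) \<and> pathstart p = x \<and> pathfinish p = y"
    using short_path_in_compact_locally_connected[OF assms, of "\<epsilon>/8"] \<epsilon> by auto
  have sub: "S \<inter> cball x (7 * (\<epsilon>/8)) \<subseteq> V"
    using \<epsilon> by (auto simp: subset_iff)
  show "\<exists>U. openin (top_of_set S) U \<and> x \<in> U \<and> U \<subseteq> V \<and>
          (\<forall>y. y \<in> U \<longrightarrow> (\<exists>p. path p \<and> path_image p \<subseteq> V \<and> pathstart p = x \<and> pathfinish p = y))"
  proof (intro exI[of _ "V \<inter> ball x d"] conjI allI impI)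
    show "openin (top_of_set S) (V \<inter> ball x d)"
      using V by (simp add: openin_Int_open)
    fix y assume "y \<in> V \<inter> ball x d"
    then have "y \<in> S" "dist x y < d"
      using V openin_imp_subset by auto
    then show "\<exists>p. path p \<and> path_image p \<subseteq> V \<and> pathstart p = x \<and> pathfinish p = y"
      using d(2)[OF \<open>x \<in> S\<close>] sub by (meson order_trans)
  qed (use V d in auto)
qed

text \<open>
  The Kuratowski embedding \<open>x \<mapsto> dist x - dist x0\<close>, in which subtracting the distance to a base
  point makes the functions bounded. It carries to metric spaces results that are proved
  with the linear structure of a Banach space.
\<close>

lemma isometric_embedding_into_banach:
  obtains e :: "'a::metric_space \<Rightarrow> ('a \<Rightarrow>\<^sub>C real)" where "\<And>x y. dist (e x) (e y) = dist x y"
proof -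
  obtain x0 :: 'a where True by blast
  define k where "k x = (\<lambda>z. dist x z - dist x0 z)" for x
  have "k x \<in> bcontfun" for x
  proof -
    have "\<bar>k x z\<bar> \<le> dist x x0" for z
      unfolding k_def using dist_triangle[of x z x0] dist_triangle[of x0 z x] by (auto simp: dist_commute)
    then have "bounded (range (k x))"
      by (auto simp: bounded_iff)
    moreover have "continuous_on UNIV (k x)"
      unfolding k_def by (intro continuous_intros)
    ultimately show ?thesis
      by (auto simp: bcontfun_def)
  qed
  then have k: "apply_bcontfun (Bcontfun (k x)) = k x" for x
    by (simp add: Bcontfun_inverse)
  have "dist (Bcontfun (k x)) (Bcontfun (k y)) = dist x y" for x y
  proof (rule antisym)
    have "\<bar>dist x z - dist y z\<bar> \<le> dist x y" for z
      using dist_triangle[of x z y] dist_triangle[of y z x] by (auto simp: dist_commute)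
    then show "dist (Bcontfun (k x)) (Bcontfun (k y)) \<le> dist x y"
      by (intro dist_bound, unfold k) (simp add: k_def dist_real_def)
    show "dist x y \<le> dist (Bcontfun (k x)) (Bcontfun (k y))"
      using dist_bounded[of "Bcontfun (k x)" y "Bcontfun (k y)"]
      unfolding k by (simp add: k_def dist_real_def)
  qed
  then show thesis
    using that[of "\<lambda>x. Bcontfun (k x)"] by blast
qed

lemma homeomorphism_isometric_image:
  assumes "\<And>x y. dist (e x) (e y) = dist x y"
  obtains e' where "homeomorphism S (e ` S) e e'"
proof -
  have "inj e"
    using assms by (metis injI dist_eq_0_iff)
  have "continuous_on S e"
    by (rule continuous_onI) (use assms in auto)
  moreover have "continuous_on (e ` S) (inv e)"
    by (rule continuous_onI) (use assms inv_f_f[OF \<open>inj e\<close>] in auto)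
  ultimately have "homeomorphism S (e ` S) e (inv e)"
    using \<open>inj e\<close> by (auto simp: homeomorphism_def image_image)
  then show thesis
    using that by blast
qed

lemma compact_locally_connected_imp_locally_path_connected:
  fixes S :: "'a::metric_space set"
  assumes "compact S" "locally connected S"
  shows "locally path_connected S"
proof -
  obtain e :: "'a \<Rightarrow> ('a \<Rightarrow>\<^sub>C real)" where e: "\<And>x y. dist (e x) (e y) = dist x y"
    using isometric_embedding_into_banach by blast
  obtain e' where hom: "homeomorphism S (e ` S) e e'"
    using homeomorphism_isometric_image[OF e] by blast
  then have eq: "S homeomorphic e ` S"
    by (auto simp: homeomorphic_def)
  have "compact (e ` S)"
    using assms eq homeomorphic_compactness by blast
  moreover have "locally connected (e ` S)"
    using homeomorphic_locally[OF eq, of connected connected] homeomorphic_connectedness assms by blast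
  ultimately have "locally path_connected (e ` S)"
    by (rule compact_locally_connected_imp_locally_path_connected_banach)
  then show ?thesis
    using homeomorphic_locally[OF eq, of path_connected path_connected] homeomorphic_path_connectedness
    by blast
qed

lemma path_contains_arc_metric:
  fixes p :: "real \<Rightarrow> 'a::metric_space"
  assumes "path p" "pathstart p = a" "pathfinish p = b" "a \<noteq> b"
  obtains q where "arc q" "path_image q \<subseteq> path_image p" "pathstart q = a" "pathfinish q = b"
proof -
  obtain e :: "'a \<Rightarrow> ('a \<Rightarrow>\<^sub>C real)" where e: "\<And>x y. dist (e x) (e y) = dist x y"
    using isometric_embedding_into_banach by blast
  obtain e' where hom: "homeomorphism (path_image p) (e ` path_image p) e e'"
    using homeomorphism_isometric_image[OF e] by blast
  have e': "continuous_on (path_image p) e" "continuous_on (e ` path_image p) e'"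
    and inv: "\<And>x. x \<in> path_image p \<Longrightarrow> e' (e x) = x"
    using hom by (auto simp: homeomorphism_def)
  have "e a \<noteq> e b"
    using assms e by (metis dist_eq_0_iff)
  moreover have "path (e \<circ> p)"
    using assms e' by (simp add: path_continuous_image)
  ultimately obtain q where q: "arc q" "path_image q \<subseteq> path_image (e \<circ> p)"
    "pathstart q = e a" "pathfinish q = e b"
    using path_contains_arc[of "e \<circ> p" "e a" "e b"] assms by (auto simp: pathstart_compose pathfinish_compose)
  have sub: "path_image q \<subseteq> e ` path_image p"
    using q(2) by (simp add: path_image_compose)
  have "inj_on e' (e ` path_image p)"
    using inv by (force intro!: inj_on_inverseI[where g = e])
  then have "arc (e' \<circ> q)"
    using q sub e'(2) unfolding arc_def path_def path_image_def
    by (meson comp_inj_on continuous_on_compose continuous_on_subset inj_on_subset)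
  moreover have "path_image (e' \<circ> q) \<subseteq> path_image p"
    using sub inv by (force simp: path_image_compose)
  moreover have "a \<in> path_image p" "b \<in> path_image p"
    using assms by auto
  ultimately show thesis
    using that[of "e' \<circ> q"] q inv by (simp add: pathstart_compose pathfinish_compose)
qed

section \<open>Arcs and separation in a dendrite\<close>

lemma dendriteD:
  assumes "dendrite X"
  shows "compact X" "connected X" "X \<noteq> {}" "locally connected X" "locally path_connected X"
  using assms compact_locally_connected_imp_locally_path_connected
  by (auto simp: dendrite_def continuum_def)

lemma openin_connected_imp_path_connected:
  assumes "locally path_connected X" "openin (top_of_set X) U" "connected U"
  shows "path_connected U"
  using locally_open_subset[OF assms(1,2)] assms(3)
  by (simp add: path_connected_component connected_iff_connected_component path_component_eq_connected_component)

lemma openin_Diff_component: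
  assumes "locally connected X" "closedin (top_of_set X) F"
  shows "openin (top_of_set X) (connected_component_set (X - F) a)"
proof -
  have "openin (top_of_set X) (X - F)"
    using assms by (metis openin_diff openin_subtopology_self)
  then show ?thesis
    using assms(1) locally_connected_2 connected_component_eq_empty[of "X - F" a]
    by (cases "a \<in> X - F") (simp_all only: openin_empty simp_thms)
qed

text \<open>
  The part of a path between two parameters, for paths in spaces without linear structure.
\<close>

definition path_segment :: "real \<Rightarrow> real \<Rightarrow> (real \<Rightarrow> 'a) \<Rightarrow> real \<Rightarrow> 'a" where
  "path_segment u v g = (\<lambda>x. g ((v - u) * x + u))"

lemma path_segment_ends [simp]:
  fixes g :: "real \<Rightarrow> 'a::topological_space"
  shows "pathstart (path_segment u v g) = g u" "pathfinish (path_segment u v g) = g v"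
  by (auto simp: pathstart_def pathfinish_def path_segment_def)

lemma path_image_segment:
  fixes g :: "real \<Rightarrow> 'a::topological_space"
  assumes "u \<le> v"
  shows "path_image (path_segment u v g) = g ` {u..v}"
proof -
  have "(\<lambda>x. (v - u) * x + u) ` {0..1} = {u..v}"
    using image_affinity_atLeastAtMost[of "v - u" u 0 1] assms by auto
  then show ?thesis
    unfolding path_image_def path_segment_def image_image[symmetric, of g "\<lambda>x. (v - u) * x + u"] by simp
qed

lemma path_path_segment:
  fixes g :: "real \<Rightarrow> 'a::topological_space"
  assumes "path g" "0 \<le> u" "u \<le> v" "v \<le> 1"
  shows "path (path_segment u v g)"
proof -
  have im: "(\<lambda>x. (v - u) * x + u) ` {0..1} = {u..v}"
    using image_affinity_atLeastAtMost[of "v - u" u 0 1] \<open>u \<le> v\<close> by auto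
  have "continuous_on {0..1} (g \<circ> (\<lambda>x. (v - u) * x + u))"
    using assms unfolding path_def
    by (intro continuous_on_compose continuous_intros) (auto simp: im intro: continuous_on_subset)
  then show ?thesis
    by (simp add: path_def path_segment_def o_def)
qed

lemma arc_path_segment:
  fixes g :: "real \<Rightarrow> 'a::topological_space"
  assumes "arc g" "0 \<le> u" "u < v" "v \<le> 1"
  shows "arc (path_segment u v g)"
proof -
  have "inj_on (path_segment u v g) {0..1}"
  proof (rule inj_onI)
    fix x y :: real assume xy: "x \<in> {0..1}" "y \<in> {0..1}" "path_segment u v g x = path_segment u v g y"
    have "(v - u) * t + u \<in> {0..1}" if "t \<in> {0..1}" for t
    proof -
      have "(v - u) * t \<le> v - u" "0 \<le> (v - u) * t"
        using that assms by (auto intro: mult_left_le)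
      then have "0 \<le> (v - u) * t + u" "(v - u) * t + u \<le> 1"
        using assms by linarith+
      then show ?thesis
        by simp
    qed
    then have "(v - u) * x + u = (v - u) * y + u"
      using xy assms by (intro inj_onD[of g "{0..1}"]) (auto simp: path_segment_def arc_def)
    then show "x = y"
      using \<open>u < v\<close> by simp
  qed
  then show ?thesis
    using assms path_path_segment[of g u v] by (simp add: arc_def)
qed

text \<open>
  If \<open>C\<close> misses the point \<open>z = p s\<close>, then it lies in one component \<open>U\<close> of \<open>X - {z}\<close>, and \<open>U\<close> contains a
  path \<open>q\<close> between the ends of \<open>p\<close>. Split the arc at \<open>z\<close> into \<open>L\<close> and \<open>R\<close>. Between the last
  visit to \<open>L\<close> before the first visit to \<open>R\<close>, and that visit, \<open>q\<close> stays off the arc; an arc inside this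
  piece of \<open>q\<close> and the part of \<open>p\<close> between its ends form a simple closed curve.
\<close>

theorem dendrite_arc_subset_connected:
  assumes X: "dendrite X" and p: "arc p" "path_image p \<subseteq> X"
    and C: "connected C" "C \<subseteq> X" "pathstart p \<in> C" "pathfinish p \<in> C"
  shows "path_image p \<subseteq> C"
proof (rule ccontr)
  assume "\<not> path_image p \<subseteq> C"
  then obtain s where s: "s \<in> {0..1}" "p s \<notin> C"
    unfolding path_image_def by blast
  define z where "z = p s"
  have zX: "z \<in> X"
    using s p by (auto simp: z_def path_image_def)
  have injp: "inj_on p {0..1}" and contp: "continuous_on {0..1} p"
    using p by (auto simp: arc_def path_def)
  define U where "U = connected_component_set (X - {z}) (p 0)"
  have "C \<subseteq> U"
    unfolding U_def using C s
    by (intro connected_component_maximal) (auto simp: pathstart_def z_def)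
  then have "p 0 \<in> U" "p 1 \<in> U"
    using C by (auto simp: pathstart_def pathfinish_def)
  moreover have "path_connected U"
  proof (rule openin_connected_imp_path_connected[OF dendriteD(5)[OF X]])
    show "openin (top_of_set X) U"
      unfolding U_def using zX by (intro openin_Diff_component dendriteD[OF X]) simp
  qed (simp add: U_def)
  ultimately have "\<exists>q. path q \<and> path_image q \<subseteq> U \<and> pathstart q = p 0 \<and> pathfinish q = p 1"
    unfolding path_connected_def by blast
  then obtain q where q: "path q" "path_image q \<subseteq> U" "q 0 = p 0" "q 1 = p 1"
    by (auto simp: pathstart_def pathfinish_def)
  have U: "U \<subseteq> X - {z}"
    unfolding U_def by (rule connected_component_subset)
  have contq: "continuous_on {0..1} q"
    using q by (simp add: path_def)
  have qz: "q t \<noteq> z" "q t \<in> X" if "t \<in> {0..1}" for t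
    using q(2) U that unfolding path_image_def by blast+
  define L where "L = p ` {0..s}"
  define R where "R = p ` {s..1}"
  have "compact L" "compact R"
    unfolding L_def R_def using s
    by (auto intro!: compact_continuous_image continuous_on_subset[OF contp])
  then have cl: "closed L" "closed R"
    by (auto intro: compact_imp_closed)
  have LR: "L \<inter> R = {z}"
  proof -
    have "L \<inter> R = p ` ({0..s} \<inter> {s..1})"
      unfolding L_def R_def by (rule inj_on_image_Int[OF injp, symmetric]) (use s in auto)
    also have "{0..s} \<inter> {s..1} = {s}"
      using s by auto
    finally show ?thesis
      by (simp add: z_def)
  qed
  have LRp: "path_image p = L \<union> R"
    unfolding L_def R_def path_image_def image_Un[symmetric] using s
    by (intro arg_cong[where f = "image p"]) auto
  have "compact ({0..1} \<inter> ({0..1} \<inter> q -` R))"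
    by (intro compact_Int_closed continuous_closed_preimage[OF contq _ cl(2)]) auto
  moreover have "1 \<in> {0..1} \<inter> q -` R"
    using q s by (auto simp: R_def)
  \<comment> \<open>\<open>t2\<close> is the first visit of \<open>q\<close> to \<open>R\<close>, and \<open>t1\<close> the last visit to \<open>L\<close> before it\<close>
  ultimately obtain t2 where t2: "t2 \<in> {0..1}" "q t2 \<in> R" "\<And>t. t \<in> {0..1} \<Longrightarrow> q t \<in> R \<Longrightarrow> t2 \<le> t"
    using compact_attains_inf[of "{0..1} \<inter> ({0..1} \<inter> q -` R)"] by (metis Int_iff vimageI2 vimageE empty_iff)
  have "compact ({0..t2} \<inter> ({0..t2} \<inter> q -` L))"
    using t2(1)
    by (intro compact_Int_closed continuous_closed_preimage[OF _ _ cl(1)] continuous_on_subset[OF contq]) auto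
  moreover have "0 \<in> {0..t2} \<inter> q -` L"
    using q s t2 by (auto simp: L_def)
  ultimately obtain t1 where t1: "t1 \<in> {0..t2}" "q t1 \<in> L" "\<And>t. t \<in> {0..t2} \<Longrightarrow> q t \<in> L \<Longrightarrow> t \<le> t1"
    using compact_attains_sup[of "{0..t2} \<inter> ({0..t2} \<inter> q -` L)"] by (metis Int_iff vimageI2 vimageE empty_iff)
  have ne: "q t1 \<noteq> q t2"
    using LR t1 t2 qz[of t2] by auto
  then have "t1 < t2"
    using t1 by (cases "t1 = t2") auto
  define m where "m = path_segment t1 t2 q"
  have m: "path m" "path_image m = q ` {t1..t2}" "pathstart m = q t1" "pathfinish m = q t2"
    unfolding m_def using q t1 t2 by (auto intro!: path_path_segment path_image_segment)
  obtain c where c: "arc c" "path_image c \<subseteq> q ` {t1..t2}" "pathstart c = q t1" "pathfinish c = q t2"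
    using path_contains_arc_metric[OF m(1,3,4) ne] m(2) by auto
  obtain a where a: "a \<in> {0..s}" "q t1 = p a"
    using t1 by (auto simp: L_def)
  obtain b where b: "b \<in> {s..1}" "q t2 = p b"
    using t2 by (auto simp: R_def)
  have "a < b"
    using a b ne by (cases "a = b") auto
  define c' where "c' = reversepath (path_segment a b p)"
  have c': "arc c'" "path_image c' = p ` {a..b}" "pathstart c' = q t2" "pathfinish c' = q t1"
    unfolding c'_def using a b \<open>a < b\<close> p s
    by (auto simp: path_image_segment intro!: arc_reversepath arc_path_segment)
  have c'p: "path_image c' \<subseteq> path_image p"
    unfolding c'(2) path_image_def[of p] using a b s by (intro image_mono) auto
  have "path_image c \<inter> path_image c' \<subseteq> {q t1, q t2}"
  proof
    fix w assume "w \<in> path_image c \<inter> path_image c'"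
    then obtain t where t: "t \<in> {t1..t2}" "w = q t" "q t \<in> L \<union> R"
      using c(2) c'p LRp by blast
    have "t = t1" if "q t \<in> L"
      using t1(3)[of t] t t1(1) that by simp
    moreover have "t = t2" if "q t \<in> R"
      using t2(3)[of t] t t1(1) t2(1) that by simp
    ultimately show "w \<in> {q t1, q t2}"
      using t by blast
  qed
  then have "simple_path (c +++ c')"
    using c c' by (intro simple_path_join_loop) auto
  moreover have "path_image (c +++ c') \<subseteq> X"
  proof -
    have "q ` {t1..t2} \<subseteq> X"
      using qz t1 t2 by auto
    then show ?thesis
      using c c' c'p p by (subst path_image_join) auto
  qed
  ultimately show False
    using X c c' unfolding dendrite_def by auto
qed

lemma dendrite_subarc_subset_connected:
  assumes X: "dendrite X" and p: "arc p" "path_image p \<subseteq> X" and C: "connected C" "C \<subseteq> X"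
    and st: "0 \<le> s" "s \<le> t" "t \<le> 1" "p s \<in> C" "p t \<in> C"
  shows "p ` {s..t} \<subseteq> C"
proof (cases "s = t")
  case False
  then have "arc (path_segment s t p)"
    using p st by (intro arc_path_segment) auto
  moreover have im: "path_image (path_segment s t p) = p ` {s..t}"
    using st by (simp add: path_image_segment)
  moreover have "p ` {s..t} \<subseteq> X"
    using p(2) st by (auto simp: path_image_def)
  ultimately show ?thesis
    using dendrite_arc_subset_connected[OF X _ _ C, of "path_segment s t p"] st by simp
qed (use st in auto)

lemma dendrite_arc_exists:
  assumes "dendrite X" "a \<in> X" "b \<in> X" "a \<noteq> b"
  obtains p where "arc p" "path_image p \<subseteq> X" "p 0 = a" "p 1 = b"
proof -
  have "path_connected X"
    by (rule openin_connected_imp_path_connected[OF dendriteD(5)[OF assms(1)] openin_subtopology_self])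
      (rule dendriteD(2)[OF assms(1)])
  then obtain q where "path q" "path_image q \<subseteq> X" "pathstart q = a" "pathfinish q = b"
    using assms unfolding path_connected_def by blast
  then show thesis
    using that by (rule_tac path_contains_arc_metric[of q a b, OF _ _ _ assms(4)])
      (auto simp: pathstart_def pathfinish_def)
qed

text \<open>
  A component whose closure avoided \<open>F\<close> would be clopen in \<open>X\<close>.
\<close>

lemma closure_component_Diff_meets:
  assumes X: "connected X" "locally connected X"
    and F: "closedin (top_of_set X) F" "F \<noteq> {}" and U: "U \<in> components (X - F)"
  shows "closure U \<inter> F \<noteq> {}"
proof
  assume disj: "closure U \<inter> F = {}"
  obtain a where a: "a \<in> X - F" "U = connected_component_set (X - F) a"
    using U by (auto simp: components_def)
  have "openin (top_of_set X) U"
    unfolding a by (rule openin_Diff_component[OF X(2) F(1)])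
  moreover have "closedin (top_of_set X) U"
  proof -
    obtain T where T: "closed T" "U = (X - F) \<inter> T"
      using closedin_component[OF U] by (auto simp: closedin_closed)
    then have "closure U \<subseteq> T"
      by (simp add: closure_minimal)
    then have "U = X \<inter> closure U"
      using T disj closure_subset[of U] by auto
    then show ?thesis
    unfolding closedin_closed by (metis closed_closure)
  qed
  ultimately have "U = {} \<or> U = X"
    using X(1) by (simp add: connected_clopen)
  moreover have "U \<noteq> {}" "U \<subseteq> X - F"
    using in_components_nonempty[OF U] in_components_subset[OF U] by auto
  ultimately show False
    using F closedin_imp_subset by blast
qed

lemma connected_insert_cutpoint:
  fixes X :: "'a::t1_space set"
  assumes "connected X" "locally connected X" "z \<in> X" "U \<in> components (X - {z})"
  shows "connected (insert z U)"
proof -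
  have "z \<in> closure U"
  proof -
    have "closedin (top_of_set X) {z}"
      using assms(3) by simp
    then show ?thesis
      using closure_component_Diff_meets[OF assms(1,2) _ _ assms(4)] by blast
  qed
  then show ?thesis
    using connected_intermediate_closure[OF in_components_connected[OF assms(4)], of "insert z U"]
      closure_subset[of U] by blast
qed

lemma closedin_insert_cutpoint:
  fixes X :: "'a::t1_space set"
  assumes "z \<in> X" "U \<in> components (X - {z})"
  shows "closedin (top_of_set X) (insert z U)"
proof -
  obtain T where T: "closed T" "U = (X - {z}) \<inter> T"
    using closedin_component[OF assms(2)] by (auto simp: closedin_closed)
  then have "insert z U = X \<inter> insert z T"
    using assms(1) by auto
  moreover have "closed (insert z T)"
    using T by simp
  ultimately show ?thesis
    unfolding closedin_closed by blast
qed

section \<open>Homeomorphisms of dendrites have fixed points\<close>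

text \<open>
  For a point \<open>a \<noteq> z\<close> of \<open>X\<close> this is the branch of \<open>X\<close> at \<open>z\<close> that points towards \<open>a\<close>; for \<open>a = z\<close> it is empty.
\<close>

abbreviation branch :: "'a::metric_space set \<Rightarrow> 'a \<Rightarrow> 'a \<Rightarrow> 'a set" where
  "branch X z a \<equiv> connected_component_set (X - {z}) a"

lemma branch_absorbs:
  assumes "connected C" "C \<subseteq> X" "z \<notin> C" "b \<in> C" "b \<in> branch X z a"
  shows "C \<subseteq> branch X z a"
proof -
  have "C \<subseteq> branch X z b"
    using assms by (intro connected_component_maximal) auto
  also have "branch X z b = branch X z a"
    using assms(5) connected_component_eq by fastforce
  finally show ?thesis .
qed

lemma branch_in_components: "a \<in> X \<Longrightarrow> a \<noteq> z \<Longrightarrow> branch X z a \<in> components (X - {z})"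
  by (simp add: componentsI)

text \<open>
  Adding \<open>w\<close> to one of the branches at \<open>w\<close> keeps it connected; as it avoids \<open>z\<close>, it lies within a single
  branch at \<open>z\<close>.
\<close>

lemma branch_nested:
  assumes X: "connected X" "locally connected X"
    and "z \<in> X" "w \<in> X" "z \<noteq> w" "b \<in> X" "b \<noteq> w" and z: "z \<notin> branch X w b"
  shows "insert w (branch X w b) \<subseteq> branch X z w"
proof (rule connected_component_maximal)
  show "connected (insert w (branch X w b))"
    using assms by (intro connected_insert_cutpoint[OF X] branch_in_components)
  show "insert w (branch X w b) \<subseteq> X - {z}"
    using assms connected_component_subset[of "X - {w}" b] by blast
qed simp

lemma homeomorphism_image_component:
  assumes hom: "homeomorphism X X g h" and "F \<subseteq> X" "a \<in> X"
  shows "g ` connected_component_set (X - F) a = connected_component_set (X - g ` F) (g a)"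
proof -
  have sub: "k ` connected_component_set (X - E) b \<subseteq> connected_component_set (X - k ` E) (k b)"
    if k: "homeomorphism X X k l" and E: "E \<subseteq> X" for k l E b
  proof (cases "b \<in> X - E")
    case True
    have CX: "connected_component_set (X - E) b \<subseteq> X - E"
      by (rule connected_component_subset)
    show ?thesis
    proof (rule connected_component_maximal)
      show "connected (k ` connected_component_set (X - E) b)"
        using homeomorphism_cont1[OF k] CX
        by (intro connected_continuous_image) (auto intro: continuous_on_subset)
      have "inj_on k X"
        using k by (metis homeomorphism_apply1 inj_on_inverseI)
      then have "k ` (X - E) = X - k ` E"
        using E homeomorphism_image1[OF k] by (simp add: inj_on_image_set_diff)
      then show "k ` connected_component_set (X - E) b \<subseteq> X - k ` E"
        using CX by blast
      show "k b \<in> k ` connected_component_set (X - E) b"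
        using True by simp
    qed
  next
    case False
    then have "connected_component_set (X - E) b = {}"
      using connected_component_eq_empty[of "X - E" b] by blast
    then show ?thesis by (simp only: image_empty empty_subsetI)
  qed
  show ?thesis
  proof
    show "g ` connected_component_set (X - F) a \<subseteq> connected_component_set (X - g ` F) (g a)"
      by (rule sub[OF hom \<open>F \<subseteq> X\<close>])
    have hg: "h ` g ` F = F" "h (g a) = a" "g ` F \<subseteq> X"
      using hom assms(2,3) homeomorphism_image1[OF hom]
      by (auto simp: homeomorphism_apply1[OF hom] subset_iff image_iff)
    have "h ` connected_component_set (X - g ` F) (g a) \<subseteq> connected_component_set (X - F) a"
      using sub[OF homeomorphism_symD[OF hom] hg(3), of "g a"] hg by simp
    moreover have "g (h y) = y" if "y \<in> connected_component_set (X - g ` F) (g a)" for y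
      using that connected_component_subset[of "X - g ` F" "g a"] homeomorphism_apply2[OF hom] by blast
    ultimately show "connected_component_set (X - g ` F) (g a) \<subseteq> g ` connected_component_set (X - F) a"
      by force
  qed
qed

lemma homeomorphism_image_branch:
  assumes "homeomorphism X X g h" "z \<in> X" "a \<in> X"
  shows "g ` branch X z a = branch X (g z) (g a)"
  using homeomorphism_image_component[OF assms(1), of "{z}" a] assms by simp

text \<open>
  If there is no fixed point, the hypothesis says that \<open>g x\<close> separates \<open>x\<close> from \<open>g (g x)\<close>. Applying powers of \<open>g\<close> and nesting
  the branches, each point of the forward orbit separates the earlier points from the later ones. So a connected
  neighbourhood of an accumulation point \<open>w\<close> that contains two points of the orbit contains all
  those between them. In particular it contains the images under \<open>g\<close> of the orbit points that accumulate
  at \<open>w\<close>. These images tend to \<open>g w\<close> by continuity, so \<open>g w = w\<close> after all.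
\<close>

lemma fixed_point_if_orbit_advances:
  assumes X: "compact X" "connected X" "locally connected X" and hom: "homeomorphism X X g h"
    and x: "x \<in> X" "x \<notin> branch X (g x) (g (g x))"
  shows "\<exists>y\<in>X. g y = y"
proof (rule ccontr)
  assume "\<not> (\<exists>y\<in>X. g y = y)"
  then have nofix: "\<And>y. y \<in> X \<Longrightarrow> g y \<noteq> y"
    by blast
  have gX: "g y \<in> X" if "y \<in> X" for y
    using that homeomorphism_image1[OF hom] by blast
  define z where "z n = (g ^^ n) x" for n
  have zS: "z (Suc n) = g (z n)" for n
    by (simp add: z_def)
  have zX: "z n \<in> X" for n
    by (induction n) (simp_all add: z_def x gX)
  have zne: "z n \<noteq> z (Suc n)" for n
    using nofix[OF zX[of n]] by (simp add: zS)
  define B where "B n = branch X (z n) (z (Suc n))" for n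
  have gB: "g ` B n = B (Suc n)" for n
    unfolding B_def zS using homeomorphism_image_branch[OF hom] zX gX by simp
  have zB: "z (Suc n) \<in> B n" for n
    unfolding B_def using zX zne[of n] by simp
  have behind: "z n \<notin> B (Suc n)" for n
  proof (induction n)
    case 0
    then show ?case
      using x by (simp add: B_def z_def)
  next
    case (Suc n)
    have "B (Suc n) \<subseteq> X"
      unfolding B_def using connected_component_subset by blast
    moreover have "inj_on g X"
      using homeomorphism_apply1[OF hom] by (rule inj_on_inverseI)
    ultimately show ?case
      using Suc zX unfolding gB[symmetric] zS by (metis inj_on_image_mem_iff)
  qed
  have step: "B (Suc n) \<subseteq> B n" for n
    using branch_nested[OF X(2,3) zX zX zne zX zne[of "Suc n", symmetric] behind[of n, unfolded B_def]]
    unfolding B_def by blast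
  have Bmono: "B m \<subseteq> B n" if "n \<le> m" for m n
    using that lift_Suc_antimono_le[of B, OF step] by blast
  have ahead: "z m \<in> B n" if "n < m" for n m
  proof (cases m)
    case (Suc k)
    then show ?thesis
      using zB[of k] Bmono[of n k] that by auto
  qed (use that in simp)
  have between: "z k \<in> V" if V: "connected V" "V \<subseteq> X" "z a \<in> V" "z b \<in> V" and ab: "a < k" "k < b"
    for V a b k
  proof (rule ccontr)
    assume "z k \<notin> V"
    then have "V \<subseteq> B k"
      using branch_absorbs[OF V(1,2), of "z k" "z b"] V(4) ahead[OF ab(2)] unfolding B_def by blast
    then show False
      using V(3) behind[of a] Bmono[of "Suc a" k] ab by auto
  qed
  obtain w r where w: "w \<in> X" "strict_mono (r :: nat \<Rightarrow> nat)" "(z \<circ> r) \<longlonglongrightarrow> w"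
    using X(1) zX unfolding compact_def by metis
  have gw: "(\<lambda>n. g (z (r n))) \<longlonglongrightarrow> g w"
    using continuous_on_tendsto_compose[OF homeomorphism_cont1[OF hom] w(3) w(1)] zX
    by (simp add: o_def)
  define d where "d = dist w (g w)"
  have "0 < d"
    using nofix[OF w(1)] by (auto simp: d_def)
  then have "openin (top_of_set X) (X \<inter> ball w (d/2))" "w \<in> X \<inter> ball w (d/2)"
    using w by (auto simp: openin_open_Int)
  then obtain V where V: "openin (top_of_set X) V" "connected V" "w \<in> V" "V \<subseteq> X \<inter> ball w (d/2)"
    using X(3) unfolding locally_connected by metis
  then obtain T where T: "open T" "V = X \<inter> T"
    by (auto simp: openin_open)
  have "\<forall>\<^sub>F n in sequentially. (z \<circ> r) n \<in> T"
    using T V by (intro topological_tendstoD[OF w(3)]) auto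
  then obtain N where N: "\<And>n. N \<le> n \<Longrightarrow> z (r n) \<in> V"
    using T zX by (auto simp: eventually_sequentially)
  have "g (z (r n)) \<in> V" if "N \<le> n" for n
  proof -
    have "r n < r (Suc n)" "r (Suc n) < r (Suc (Suc n))"
      using w(2) by (auto simp: strict_mono_def)
    then show ?thesis
      using between[OF V(2) _ N[of n] N[of "Suc (Suc n)"], of "Suc (r n)"] V that by (auto simp: zS)
  qed
  then have "\<forall>n\<ge>N. g (z (r n)) \<in> ball w (d/2)"
    using V by blast
  then have "\<forall>n\<ge>N. dist w (g (z (r n))) \<le> d/2"
    by (simp add: less_imp_le)
  then have "d \<le> d/2"
    unfolding d_def using Lim_bounded[OF tendsto_dist[OF tendsto_const gw]] by blast
  then show False
    using \<open>0 < d\<close> by simp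
qed

text \<open>
  Let \<open>P\<close> be a path from \<open>g (p t)\<close> to \<open>c\<close> that avoids \<open>p t\<close>, and \<open>V\<close> a connected neighbourhood of
  \<open>g (p t)\<close> away from \<open>p t\<close>. For \<open>s\<close> near \<open>t\<close>, the connected set \<open>P \<union> V\<close> contains \<open>g (p s)\<close> and \<open>c\<close> but
  not \<open>p s\<close>.
\<close>

lemma open_set_of_branching_towards:
  assumes X: "dendrite X" and p: "continuous_on {0..1} p" "p ` {0..1} \<subseteq> X"
    and g: "continuous_on X g" "g ` X \<subseteq> X"
  shows "openin (top_of_set {0..1::real}) {t \<in> {0..1}. c \<in> branch X (p t) (g (p t))}"
  unfolding openin_euclidean_subtopology_iff
proof (intro conjI ballI)
  fix t assume "t \<in> {t \<in> {0..1}. c \<in> branch X (p t) (g (p t))}"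
  then have t: "t \<in> {0..1}" "c \<in> branch X (p t) (g (p t))"
    by auto
  have pX: "p s \<in> X" if "s \<in> {0..1}" for s
    using that p by auto
  let ?U = "branch X (p t) (g (p t))"
  have U: "?U \<subseteq> X - {p t}"
    by (rule connected_component_subset)
  have gpt: "g (p t) \<in> ?U"
    using t(2) connected_component_in by fastforce
  have "path_connected ?U"
    using pX[OF t(1)] by (intro openin_connected_imp_path_connected[OF dendriteD(5)[OF X]] openin_Diff_component dendriteD[OF X]) auto
  then obtain q where q: "path q" "path_image q \<subseteq> ?U" "pathstart q = g (p t)" "pathfinish q = c"
    using t gpt unfolding path_connected_def by blast
  define P where "P = path_image q"
  have P: "compact P" "connected P" "P \<subseteq> X" "p t \<notin> P" "g (p t) \<in> P" "c \<in> P"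
    using q U pathstart_in_path_image[of q] pathfinish_in_path_image[of q] unfolding P_def
    by (auto simp: compact_path_image connected_path_image)
  \<comment> \<open>a connected neighbourhood of \<open>g (p t)\<close> that stays away from \<open>p t\<close>\<close>
  define e where "e = dist (p t) (g (p t)) / 2"
  have e: "0 < e"
    using P by (auto simp: e_def)
  have "openin (top_of_set X) (X \<inter> ball (g (p t)) e)" "g (p t) \<in> X \<inter> ball (g (p t)) e"
    using P e by (auto simp: openin_open_Int)
  then obtain V where V: "openin (top_of_set X) V" "connected V" "g (p t) \<in> V" "V \<subseteq> X \<inter> ball (g (p t)) e"
    using dendriteD(4)[OF X] unfolding locally_connected by metis
  then obtain T where T: "open T" "V = X \<inter> T"
    by (auto simp: openin_open)
  have gp: "continuous_on {0..1} (\<lambda>s. g (p s))"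
    using continuous_on_compose2[OF g(1) p(1)] p(2) by blast
  have "\<forall>\<^sub>F s in at t within {0..1}. g (p s) \<in> T"
    using gp t(1) T V by (intro topological_tendstoD) (auto simp: continuous_on)
  moreover have "\<forall>\<^sub>F s in at t within {0..1}. p s \<in> - P \<inter> ball (p t) e"
    using p(1) t(1) P e by (intro topological_tendstoD) (auto simp: continuous_on open_Compl compact_imp_closed)
  ultimately have "\<forall>\<^sub>F s in at t within {0..1}. g (p s) \<in> T \<and> p s \<in> - P \<inter> ball (p t) e"
    by eventually_elim auto
  then obtain r where r: "0 < r"
    "\<And>s. s \<in> {0..1} \<Longrightarrow> s \<noteq> t \<Longrightarrow> dist s t < r \<Longrightarrow> g (p s) \<in> T \<and> p s \<in> - P \<inter> ball (p t) e"
    unfolding eventually_at by blast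
  show "\<exists>r>0. \<forall>s\<in>{0..1}. dist s t < r \<longrightarrow> s \<in> {t \<in> {0..1}. c \<in> branch X (p t) (g (p t))}"
  proof (intro exI[of _ r] conjI ballI impI)
    fix s assume s: "s \<in> {0..1::real}" "dist s t < r"
    have "c \<in> branch X (p s) (g (p s))"
    proof (cases "s = t")
      case False
      then have s': "g (p s) \<in> T" "p s \<notin> P" "dist (p t) (p s) < e"
        using r(2)[of s] s by auto
      have "g (p s) \<in> V"
        using s' T pX[OF s(1)] g by auto
      have "p s \<notin> V"
      proof
        assume "p s \<in> V"
        then have "dist (g (p t)) (p s) < e"
          using V by auto
        then show False
          using s'(3) dist_triangle2[of "p t" "g (p t)" "p s"] by (simp add: e_def)
      qed
      have "P \<union> V \<subseteq> branch X (p s) (g (p s))"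
      proof (rule connected_component_maximal)
        show "connected (P \<union> V)"
          using P V by (intro connected_Un) auto
      qed (use \<open>g (p s) \<in> V\<close> \<open>p s \<notin> V\<close> s' P V in auto)
      then show ?thesis
        using P by auto
    qed (use t in auto)
    then show "s \<in> {t \<in> {0..1}. c \<in> branch X (p t) (g (p t))}"
      using s(1) by simp
  qed (rule r)
qed auto

text \<open>
  Suppose that there is no fixed point. Then no orbit advances in the sense of
  \<open>fixed_point_if_orbit_advances\<close>, which means that \<open>g (g x)\<close> always lies on the same side of \<open>g x\<close> as
  \<open>x\<close>. Follow the arc \<open>p\<close> from \<open>x\<close> to \<open>g x\<close>. At its start \<open>g\<close> moves the point towards \<open>p 1\<close>, at its
  end towards \<open>p 0\<close>. These are disjoint open conditions on the parameter, so by connectedness some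
  point \<open>z\<close> of the arc is moved into a branch \<open>E\<close> at \<open>z\<close> that contains neither end. The arc from \<open>z\<close> to
  \<open>g x\<close> avoids \<open>g z\<close>, while \<open>g x\<close> is not in the branch \<open>g ` E\<close> at \<open>g z\<close> because \<open>x\<close> is not in \<open>E\<close>. So
  \<open>z\<close> is not in \<open>g ` E\<close> either, which says that the orbit of \<open>z\<close> advances.
\<close>

theorem dendrite_homeomorphism_fixed_point:
  assumes X: "dendrite X" and hom: "homeomorphism X X g h"
  shows "\<exists>y\<in>X. g y = y"
proof (rule ccontr)
  assume "\<not> (\<exists>y\<in>X. g y = y)"
  then have nofix: "\<And>y. y \<in> X \<Longrightarrow> g y \<noteq> y"
    by blast
  have advance: "x \<in> branch X (g x) (g (g x))" if "x \<in> X" for x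
    using fixed_point_if_orbit_advances[OF dendriteD(1,2,4)[OF X] hom that] nofix by blast
  have gX: "g y \<in> X" if "y \<in> X" for y
    using that homeomorphism_image1[OF hom] by blast
  have inj: "inj_on g X"
    using homeomorphism_apply1[OF hom] by (rule inj_on_inverseI)
  obtain x where x: "x \<in> X"
    using dendriteD(3)[OF X] by blast
  obtain p where p: "arc p" "path_image p \<subseteq> X" "p 0 = x" "p 1 = g x"
    using dendrite_arc_exists[OF X x gX[OF x]] nofix[OF x] by metis
  have contp: "continuous_on {0..1} p" "p ` {0..1} \<subseteq> X"
    using p by (auto simp: arc_def path_def path_image_def)
  then have pX: "p t \<in> X" if "t \<in> {0..1}" for t
    using that by auto
  define F where "F c = {t \<in> {0..1}. c \<in> branch X (p t) (g (p t))}" for c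
  have open_F: "openin (top_of_set {0..1}) (F c)" for c
    unfolding F_def using homeomorphism_cont1[OF hom] homeomorphism_image1[OF hom]
    by (intro open_set_of_branching_towards[OF X contp]) auto
  have "0 \<in> F (p 1)"
    unfolding F_def using p x gX nofix[OF x] by simp
  moreover have "1 \<in> F (p 0)"
    unfolding F_def using p advance[OF x] connected_component_sym by auto
  moreover have "F (p 0) \<inter> F (p 1) = {}"
  proof (rule ccontr)
    assume "F (p 0) \<inter> F (p 1) \<noteq> {}"
    then obtain t where t: "t \<in> {0..1}" "p 0 \<in> branch X (p t) (g (p t))" "p 1 \<in> branch X (p t) (g (p t))"
      by (auto simp: F_def)
    have "path_image p \<subseteq> branch X (p t) (g (p t))"
      using t connected_component_subset[of "X - {p t}" "g (p t)"]
      by (intro dendrite_arc_subset_connected[OF X p(1,2)]) (auto simp: pathstart_def pathfinish_def)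
    then show False
      using t(1) connected_component_subset[of "X - {p t}" "g (p t)"] unfolding path_image_def by blast
  qed
  moreover have "connected {0..1::real}"
    by simp
  ultimately have "\<not> {0..1} \<subseteq> F (p 0) \<union> F (p 1)"
    using open_F[of "p 0"] open_F[of "p 1"] unfolding connected_openin F_def by blast
  then obtain t where t: "t \<in> {0..1}" "t \<notin> F (p 0)" "t \<notin> F (p 1)"
    by blast
  define z where "z = p t"
  define E where "E = branch X z (g z)"
  have zX: "z \<in> X" "g z \<noteq> z" "g z \<in> X"
    using pX t nofix gX by (auto simp: z_def)
  have E: "x \<notin> E" "p 1 \<notin> E"
    using t p by (auto simp: F_def E_def z_def)
  have gE: "g ` E = branch X (g z) (g (g z))"
    unfolding E_def using homeomorphism_image_branch[OF hom] zX by simp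
  have EX: "E \<subseteq> X"
    unfolding E_def using connected_component_subset by blast
  \<comment> \<open>the part of the arc from \<open>z\<close> to \<open>g x\<close> avoids \<open>g z\<close>\<close>
  have "g z \<notin> p ` {t..1}"
  proof
    assume "g z \<in> p ` {t..1}"
    then obtain s where s: "s \<in> {t..1}" "g z = p s"
      by blast
    then have "t < s"
      using zX by (cases "s = t") (auto simp: z_def)
    have "p ` {s..1} \<subseteq> E"
      unfolding E_def
    proof (rule connected_component_maximal)
      show "connected (p ` {s..1})"
        using s t by (intro connected_continuous_image continuous_on_subset[OF contp(1)]) auto
      have pz: "p u \<noteq> z" if "u \<in> {s..1}" for u
        using that \<open>t < s\<close> t(1) p(1) inj_onD[of p "{0..1}" u t] by (auto simp: z_def arc_def)
      moreover have "p ` {s..1} \<subseteq> X"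
        using pX s(1) t(1) by auto
      ultimately show "p ` {s..1} \<subseteq> X - {z}"
        by blast
    qed (use s in auto)
    then have "p 1 \<in> E"
      using s by (meson atLeastAtMost_iff image_subset_iff order_refl)
    then show False
      using E by simp
  qed
  moreover have "connected (p ` {t..1})"
    using t by (intro connected_continuous_image continuous_on_subset[OF contp(1)]) auto
  moreover have "p ` {t..1} \<subseteq> X"
    using t pX by auto
  moreover have "z \<in> p ` {t..1}" "g x \<in> p ` {t..1}"
    using t p(4) by (auto simp: z_def image_iff intro: bexI[of _ t] bexI[of _ 1])
  moreover have "z \<in> g ` E"
    using advance[OF zX(1)] gE by simp
  ultimately have "g x \<in> g ` E"
    using branch_absorbs[of "p ` {t..1}" X "g z" z "g (g z)"] unfolding gE by blast
  then show False
    using inj E(1) EX x by (metis inj_on_image_mem_iff)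
qed

section \<open>Integer iterates of a homeomorphism\<close>

lemma homeomorphism_inv_into:
  assumes "homeomorphism X X g h"
  shows "homeomorphism X X g (inv_into X g)"
proof -
  have "inj_on g X"
    using homeomorphism_apply1[OF assms] by (rule inj_on_inverseI)
  have "inv_into X g y = h y" if "y \<in> X" for y
    using that assms \<open>inj_on g X\<close>
    by (metis homeomorphism_apply2 homeomorphism_image2 image_eqI inv_into_f_eq)
  then show ?thesis
    by (intro homeomorphism_cong[OF assms]) auto
qed

context
  fixes X :: "'a::metric_space set" and g h :: "'a \<Rightarrow> 'a"
  assumes hom: "homeomorphism X X g h"
begin

lemma homeomorphism_self_inj: "inj_on g X"
  using homeomorphism_apply1[OF hom] by (rule inj_on_inverseI)

lemma int_iter_0 [simp]: "int_iter X g 0 x = x"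
  by (simp add: int_iter_def)

lemma int_iter_in: "x \<in> X \<Longrightarrow> int_iter X g n x \<in> X"
proof -
  assume "x \<in> X"
  have "(f ^^ k) x \<in> X" if "f ` X = X" for f :: "'a \<Rightarrow> 'a" and k
    by (induction k) (use \<open>x \<in> X\<close> that in auto)
  then show ?thesis
    using homeomorphism_image1[OF homeomorphism_inv_into[OF hom]]
      homeomorphism_image2[OF homeomorphism_inv_into[OF hom]]
    by (auto simp: int_iter_def)
qed

lemma int_iter_Suc:
  assumes "x \<in> X"
  shows "int_iter X g (n + 1) x = g (int_iter X g n x)"
proof (cases "0 \<le> n")
  case True
  then show ?thesis
    by (simp add: int_iter_def nat_add_distrib)
next
  case False
  define k where "k = nat (- (n + 1))"
  have k: "nat (- n) = Suc k" "int_iter X g (n + 1) x = (inv_into X g ^^ k) x"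
    using False by (auto simp: k_def int_iter_def)
  then have "int_iter X g n x = inv_into X g (int_iter X g (n + 1) x)"
    using False by (simp add: int_iter_def)
  then show ?thesis
    using homeomorphism_apply2[OF homeomorphism_inv_into[OF hom] int_iter_in[OF assms]] by simp
qed

text \<open>
  A family of sets that \<open>g\<close> shifts by one is shifted by \<open>k\<close> under the \<open>k\<close>-th iterate. Constant families
  give invariance, and families of singletons give the rules for iterates of a point.
\<close>

lemma int_iter_image_shift:
  assumes S: "\<And>n. S n \<subseteq> X" "\<And>n::int. g ` S n = S (n + 1)"
  shows "int_iter X g k ` S n = S (n + k)"
proof (induction k rule: int_induct[where k = 0])
  case base
  then show ?case by simp
next
  case (step1 i)
  have "int_iter X g (i + 1) ` S n = g ` int_iter X g i ` S n"
    unfolding image_image using S(1)[of n] by (intro image_cong refl int_iter_Suc) auto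
  then show ?case
    using step1 S(2)[of "n + i"] by (simp add: add.assoc)
next
  case (step2 i)
  have "g ` int_iter X g (i - 1) ` S n = int_iter X g i ` S n"
    unfolding image_image using S(1)[of n] int_iter_Suc[of _ "i - 1"] by (intro image_cong refl) auto
  also have "\<dots> = g ` S (n + (i - 1))"
    using step2 S(2)[of "n + (i - 1)"] by (simp add: add.assoc)
  finally have "g ` int_iter X g (i - 1) ` S n = g ` S (n + (i - 1))" .
  moreover have "int_iter X g (i - 1) ` S n \<subseteq> X"
    using S(1)[of n] int_iter_in by blast
  ultimately show ?case
    using inj_on_image_eq_iff[OF homeomorphism_self_inj _ S(1)] by simp
qed

lemma int_iter_image_invariant:
  assumes "S \<subseteq> X" "g ` S = S"
  shows "int_iter X g k ` S = S"
  using int_iter_image_shift[of "\<lambda>_. S" k] assms by simp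

lemma int_iter_uminus:
  assumes "x \<in> X"
  shows "int_iter X g (- k) (int_iter X g k x) = x"
proof -
  define S where "S n = {int_iter X g n x}" for n
  have "int_iter X g (- k) ` S k = S (k + - k)"
    using assms int_iter_in int_iter_Suc by (intro int_iter_image_shift) (auto simp: S_def)
  then show ?thesis
    by (simp add: S_def)
qed

end

section \<open>The region around a translated arc\<close>

text \<open>
  An arc from one fixed point to another, together with the parameters \<open>u n\<close> of a two-sided orbit in
  its interior that moves from the start of the arc to its end.
\<close>

locale translated_arc =
  fixes X :: "'a::metric_space set" and g h :: "'a \<Rightarrow> 'a" and p :: "real \<Rightarrow> 'a" and u :: "int \<Rightarrow> real"
  assumes X: "dendrite X" and hom: "homeomorphism X X g h"
    and p: "arc p" "path_image p \<subseteq> X" and ends: "g (p 0) = p 0" "g (p 1) = p 1"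
    and u01: "0 < u n" "u n < 1" and u_less: "u n < u (n + 1)" and gu: "g (p (u n)) = p (u (n + 1))"
    and u_top: "(\<lambda>n. u (int n)) \<longlonglongrightarrow> 1" and u_bot: "(\<lambda>n. u (- int n)) \<longlonglongrightarrow> 0"
begin

definition orbit where "orbit n = p (u n)"
text \<open>
  The branch beyond the \<open>n\<close>-th point of the orbit, seen from the start of the arc.
\<close>

definition beyond where "beyond n = branch X (orbit n) (p 1)"
definition region where "region = connected_component_set (X - {p 0, p 1}) (orbit 0)"

lemma u_mono: "m < n \<Longrightarrow> u m < u n"
  by (induction n rule: int_gr_induct) (use u_less less_trans in blast)+

lemma p_inj: "s \<in> {0..1} \<Longrightarrow> t \<in> {0..1} \<Longrightarrow> p s = p t \<longleftrightarrow> s = t"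
  using p inj_on_eq_iff[of p "{0..1}"] by (auto simp: arc_def)

lemma pX: "t \<in> {0..1} \<Longrightarrow> p t \<in> X"
  using p by (auto simp: path_image_def)

lemma p_cont: "continuous_on {0..1} p"
  using p by (simp add: arc_def path_def)

lemma orbit_in_X: "orbit n \<in> X"
  using pX[of "u n"] u01[of n] by (simp add: orbit_def)

lemma endsX: "p 0 \<in> X" "p 1 \<in> X"
  using pX by auto

lemma orbit_ne_ends: "orbit n \<noteq> p 0" "orbit n \<noteq> p 1" "p 0 \<noteq> orbit n" "p 1 \<noteq> orbit n"
  using p_inj[of "u n" 0] p_inj[of "u n" 1] u01[of n] by (auto simp: orbit_def)

lemma orbit_eq_iff: "orbit m = orbit n \<longleftrightarrow> m = n"
proof -
  have "u m = u n \<longleftrightarrow> m = n"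
    using u_mono[of m n] u_mono[of n m] by (cases m n rule: linorder_cases) auto
  then show ?thesis
    using p_inj[of "u m" "u n"] u01[of n] u01[of m] by (simp add: orbit_def less_imp_le)
qed

lemma image_orbit: "g (orbit n) = orbit (n + 1)"
  by (simp add: orbit_def gu)

lemma beyond_sub: "beyond n \<subseteq> X - {orbit n}"
  unfolding beyond_def by (rule connected_component_subset)

lemma beyond_open: "openin (top_of_set X) (beyond n)"
  unfolding beyond_def using orbit_in_X by (intro openin_Diff_component dendriteD[OF X]) auto

lemma beyond_connected: "connected (beyond n)"
  by (simp add: beyond_def)

lemma finish_in_beyond: "p 1 \<in> beyond n"
  unfolding beyond_def using endsX orbit_ne_ends by auto

lemma image_beyond: "g ` beyond n = beyond (n + 1)"
  unfolding beyond_def using homeomorphism_image_branch[OF hom orbit_in_X endsX(2)] image_orbit ends by simp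

lemma beyond_closed: "closedin (top_of_set X) (insert (orbit n) (beyond n))"
  unfolding beyond_def using endsX orbit_ne_ends
  by (intro closedin_insert_cutpoint orbit_in_X branch_in_components) metis+

lemma beyond_absorbs: "connected C \<Longrightarrow> C \<subseteq> X \<Longrightarrow> orbit n \<notin> C \<Longrightarrow> b \<in> C \<Longrightarrow> b \<in> beyond n \<Longrightarrow> C \<subseteq> beyond n"
  unfolding beyond_def by (rule branch_absorbs)

lemma connected_subarc: "0 \<le> s \<Longrightarrow> t \<le> 1 \<Longrightarrow> connected (p ` {s..t})"
  by (intro connected_continuous_image continuous_on_subset[OF p_cont]) auto

lemma arc_in_beyond:
  assumes "u n < t" "t \<le> 1"
  shows "p t \<in> beyond n"
proof -
  have "p ` {t..1} \<subseteq> beyond n"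
  proof (rule beyond_absorbs)
    show "connected (p ` {t..1})"
      using assms u01[of n] by (intro connected_subarc) auto
    show "p ` {t..1} \<subseteq> X"
      using assms u01[of n] pX by auto
    show "orbit n \<notin> p ` {t..1}"
    proof
      assume "orbit n \<in> p ` {t..1}"
      then obtain s where "s \<in> {t..1}" "orbit n = p s"
        by auto
      then show False
        using p_inj[of s "u n"] assms u01[of n] by (auto simp: orbit_def)
    qed
  qed (use assms finish_in_beyond in auto)
  then show ?thesis
    using assms by auto
qed

lemma arc_notin_beyond:
  assumes "0 \<le> t" "t \<le> u n"
  shows "p t \<notin> beyond n"
proof
  assume "p t \<in> beyond n"
  then have "p ` {t..1} \<subseteq> beyond n"
    using assms u01[of n] finish_in_beyond beyond_sub beyond_connected
    by (intro dendrite_subarc_subset_connected[OF X p]) auto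
  moreover have "orbit n \<in> p ` {t..1}"
    using assms u01[of n] by (auto simp: orbit_def)
  ultimately show False
    using beyond_sub by blast
qed

lemma orbit_in_beyond_iff: "orbit m \<in> beyond n \<longleftrightarrow> n < m"
proof (cases "n < m")
  case True
  then show ?thesis
    using arc_in_beyond[OF u_mono[OF True]] u01[of m] by (simp add: orbit_def less_imp_le)
next
  case False
  then have "u m \<le> u n"
    using u_mono[of m n] by (cases "m = n") auto
  then show ?thesis
    using arc_notin_beyond[of "u m" n] u01[of m] False by (simp add: orbit_def less_imp_le)
qed

lemma start_notin_beyond: "p 0 \<notin> beyond n"
  using arc_notin_beyond[of 0 n] u01[of n] by auto

lemma beyond_nested_insert:
  assumes "n < m"
  shows "insert (orbit m) (beyond m) \<subseteq> beyond n"
proof -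
  have "orbit n \<noteq> orbit m" "orbit n \<notin> beyond m"
    using assms orbit_in_beyond_iff[of n m] orbit_eq_iff[of n m] by auto
  then have "insert (orbit m) (beyond m) \<subseteq> branch X (orbit n) (orbit m)"
    unfolding beyond_def by (intro branch_nested[OF dendriteD(2,4)[OF X] orbit_in_X orbit_in_X _ endsX(2) orbit_ne_ends(4)])
  also have "\<dots> = beyond n"
    unfolding beyond_def by (rule connected_component_eq) (use orbit_in_beyond_iff[of m n] assms in \<open>simp add: beyond_def\<close>)
  finally show ?thesis .
qed

lemma beyond_antimono:
  assumes "n \<le> m"
  shows "beyond m \<subseteq> beyond n"
proof (cases "n = m")
  case False
  then have "insert (orbit m) (beyond m) \<subseteq> beyond n"
    using assms by (intro beyond_nested_insert) simp
  then show ?thesis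
    by blast
qed simp

lemma region_open: "openin (top_of_set X) region"
  unfolding region_def
proof (rule openin_Diff_component[OF dendriteD(4)[OF X]])
  show "closedin (top_of_set X) {p 0, p 1}"
    using endsX by (intro closed_subset) auto
qed

lemma region_connected: "connected region"
  by (simp add: region_def)

lemma region_sub: "region \<subseteq> X - {p 0, p 1}"
  unfolding region_def by (rule connected_component_subset)

lemma region_absorbs:
  assumes "connected C" "C \<subseteq> X" "p 0 \<notin> C" "p 1 \<notin> C" "b \<in> C" "b \<in> region"
  shows "C \<subseteq> region"
proof -
  have "C \<subseteq> connected_component_set (X - {p 0, p 1}) b"
    using assms by (intro connected_component_maximal) auto
  then show ?thesis
    using assms(6) connected_component_eq[of b "X - {p 0, p 1}" "orbit 0"] unfolding region_def by simp
qed

lemma arc_interior_subset_region: "p ` {0<..<1} \<subseteq> region"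
proof (rule region_absorbs)
  show "connected (p ` {0<..<1})"
    by (intro connected_continuous_image continuous_on_subset[OF p_cont]) auto
  show "p ` {0<..<1} \<subseteq> X"
    using pX by auto
  show "p 0 \<notin> p ` {0<..<1}"
  proof
    assume "p 0 \<in> p ` {0<..<1}"
    then obtain s where "s \<in> {0<..<1}" "p 0 = p s" by auto
    then show False using p_inj[of 0 s] by auto
  qed
  show "p 1 \<notin> p ` {0<..<1}"
  proof
    assume "p 1 \<in> p ` {0<..<1}"
    then obtain s where "s \<in> {0<..<1}" "p 1 = p s" by auto
    then show False using p_inj[of 1 s] by auto
  qed
  show "orbit 0 \<in> p ` {0<..<1}"
    using u01[of 0] by (auto simp: orbit_def)
  show "orbit 0 \<in> region"
    unfolding region_def using orbit_in_X orbit_ne_ends by auto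
qed

lemma orbit_in_region: "orbit n \<in> region"
  using arc_interior_subset_region u01[of n] by (auto simp: orbit_def)

lemma image_region: "g ` region = region"
proof -
  have "g ` region = connected_component_set (X - {p 0, p 1}) (orbit 1)"
    unfolding region_def using homeomorphism_image_component[OF hom, of "{p 0, p 1}" "orbit 0"] endsX orbit_in_X ends image_orbit[of 0]
    by simp
  also have "\<dots> = region"
    using connected_component_eq[of "orbit 1" "X - {p 0, p 1}" "orbit 0"] orbit_in_region[of 1] by (simp add: region_def)
  finally show ?thesis .
qed

text \<open>
  A path from \<open>orbit 0\<close> to \<open>w\<close> inside the region is compact and misses both ends, hence misses
  \<open>orbit n\<close> for large \<open>\<bar>n\<bar>\<close>. It therefore stays on the same side of \<open>orbit n\<close> as \<open>orbit 0\<close>.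
\<close>

lemma region_eventually:
  assumes w: "w \<in> region"
  shows "\<forall>\<^sub>F n in sequentially. w \<in> beyond (- int n) - insert (orbit (int n)) (beyond (int n))"
proof -
  have "path_connected region"
    by (rule openin_connected_imp_path_connected[OF dendriteD(5)[OF X] region_open region_connected])
  then obtain q where q: "path q" "path_image q \<subseteq> region" "pathstart q = orbit 0" "pathfinish q = w"
    using orbit_in_region w unfolding path_connected_def by blast
  define P where "P = path_image q"
  have P: "closed P" "connected P" "P \<subseteq> X" "orbit 0 \<in> P" "w \<in> P" "p 0 \<notin> P" "p 1 \<notin> P"
    using q region_sub pathstart_in_path_image[of q] pathfinish_in_path_image[of q] unfolding P_def
    by (auto simp: compact_path_image compact_imp_closed connected_path_image)
  have "(\<lambda>n. orbit (int n)) \<longlonglongrightarrow> p 1" "(\<lambda>n. orbit (- int n)) \<longlonglongrightarrow> p 0"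
    unfolding orbit_def using u01
    by (auto intro!: continuous_on_tendsto_compose[OF p_cont u_top] continuous_on_tendsto_compose[OF p_cont u_bot]
        always_eventually less_imp_le)
  then have "\<forall>\<^sub>F n in sequentially. orbit (int n) \<in> - P" "\<forall>\<^sub>F n in sequentially. orbit (- int n) \<in> - P"
    using P by (auto intro: topological_tendstoD simp del: Compl_iff)
  then show ?thesis
    using eventually_gt_at_top[of 0]
  proof eventually_elim
    case (elim n)
    then have "P \<subseteq> beyond (- int n)"
      using P orbit_in_beyond_iff[of 0 "- int n"] by (intro beyond_absorbs[of P _ "orbit 0"]) auto
    moreover have "w \<notin> beyond (int n)"
    proof
      assume "w \<in> beyond (int n)"
      then have "P \<subseteq> beyond (int n)"
        using P elim by (intro beyond_absorbs[of P _ w]) auto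
      then show False
        using P orbit_in_beyond_iff[of 0 "int n"] by auto
    qed
    ultimately show ?case
      using P elim by auto
  qed
qed

text \<open>
  A component \<open>Q\<close> of \<open>X - {p 0, p 1}\<close> other than the region has one of the two ends \<open>e\<close> in its closure,
  so \<open>insert e Q\<close> is a connected set which contains no point of the orbit: it lies on the same side as
  \<open>e\<close> of all of them.
\<close>

lemma outside_region:
  assumes w: "w \<in> X" "w \<notin> region"
  shows "(\<forall>n. w \<in> beyond n) \<or> (\<forall>n. w \<notin> beyond n)"
proof (cases "w \<in> {p 0, p 1}")
  case True
  then show ?thesis
    using start_notin_beyond finish_in_beyond by auto
next
  case False
  define Q where "Q = connected_component_set (X - {p 0, p 1}) w"
  have wQ: "w \<in> Q" and Qsub: "Q \<subseteq> X - {p 0, p 1}" and "connected Q"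
    using False w connected_component_subset unfolding Q_def by (auto)
  have zQ: "orbit n \<notin> Q" for n
  proof
    assume "orbit n \<in> Q"
    then have "Q \<subseteq> region"
      using Qsub \<open>connected Q\<close> orbit_in_region by (intro region_absorbs[of Q "orbit n"]) auto
    then show False
      using wQ w by auto
  qed
  have "closedin (top_of_set X) {p 0, p 1}"
    using endsX by (intro closed_subset) auto
  moreover have "Q \<in> components (X - {p 0, p 1})"
    unfolding Q_def using False w by (intro componentsI) auto
  ultimately have "closure Q \<inter> {p 0, p 1} \<noteq> {}"
    by (intro closure_component_Diff_meets[OF dendriteD(2,4)[OF X]]) auto
  then obtain e where e: "e \<in> {p 0, p 1}" "e \<in> closure Q"
    by auto
  have con: "connected (insert e Q)"
    using connected_intermediate_closure[OF \<open>connected Q\<close>, of "insert e Q"] e closure_subset[of Q] by blast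
  have sub: "insert e Q \<subseteq> X" "orbit n \<notin> insert e Q" for n
    using e endsX Qsub zQ[of n] orbit_ne_ends[of n] by auto
  have "w \<in> beyond n \<longleftrightarrow> e \<in> beyond n" for n
    using beyond_absorbs[OF con sub, of w n] beyond_absorbs[OF con sub, of e n] wQ by blast
  then show ?thesis
    using e start_notin_beyond finish_in_beyond by auto
qed

text \<open>
  The compact set is \<open>S 0\<close>, the part of \<open>X\<close> that is beyond \<open>orbit 0\<close> (or equal to it) but not beyond
  \<open>orbit 1\<close>. A point of the region lies in the translate \<open>S k\<close> for any index \<open>k\<close> at which it ceases to be
  beyond the orbit. Taking the complement of \<open>beyond 1\<close>, instead of the branch at \<open>orbit 1\<close> that
  contains the start of the arc, ensures that the other branches at \<open>orbit 1\<close> are covered.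
\<close>

lemma region_cocompact: "acts_cocompactly X g region"
  unfolding acts_cocompactly_def
proof (intro exI conjI)
  define S where "S n = insert (orbit n) (beyond n) - beyond (n + 1)" for n
  have SX: "S n \<subseteq> X" for n
    using orbit_in_X beyond_sub by (auto simp: S_def)
  have gS: "g ` S n = S (n + 1)" for n
  proof -
    have "g ` S n = g ` insert (orbit n) (beyond n) - g ` beyond (n + 1)"
      unfolding S_def using orbit_in_X beyond_sub beyond_sub[of "n + 1"]
      by (intro inj_on_image_set_diff[OF homeomorphism_self_inj[OF hom]]) auto
    then show ?thesis
      by (simp add: S_def image_beyond image_orbit)
  qed
  have "closedin (top_of_set X) (S 0)"
    unfolding S_def by (intro closedin_diff beyond_closed beyond_open)
  then show "compact (S 0)"
    using dendriteD(1)[OF X] closedin_compact by blast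
  have S_region: "S n \<subseteq> region" for n
  proof
    fix w assume w: "w \<in> S n"
    show "w \<in> region"
    proof (rule ccontr)
      assume "w \<notin> region"
      then show False
        using outside_region[of w] w SX[of n] orbit_in_region[of n] by (auto simp: S_def)
    qed
  qed
  then show "S 0 \<subseteq> region" .
  have "(\<Union>n. int_iter X g n ` S 0) = (\<Union>n. S n)"
    using int_iter_image_shift[OF hom, of S _ 0] SX gS by simp
  also have "\<dots> = region"
  proof
    show "region \<subseteq> (\<Union>n. S n)"
    proof
      fix w assume "w \<in> region"
      then obtain N where N: "w \<in> beyond (- int N)" "w \<notin> beyond (int N)"
        using eventually_happens[OF region_eventually] by auto
      \<comment> \<open>otherwise membership in \<open>beyond\<close> would propagate from \<open>- N\<close> to \<open>N\<close>\<close>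
      have "\<exists>k. w \<in> beyond k \<and> w \<notin> beyond (k + 1)"
      proof (rule ccontr)
        assume step: "\<not> (\<exists>k. w \<in> beyond k \<and> w \<notin> beyond (k + 1))"
        have "w \<in> beyond (int N)"
          by (rule int_ge_induct[of "- int N" "int N"]) (use N step in auto)
        then show False
          using N by simp
      qed
      then show "w \<in> (\<Union>n. S n)"
        by (auto simp: S_def)
    qed
  qed (use S_region in auto)
  finally show "(\<Union>n. int_iter X g n ` S 0) = region" .
qed

text \<open>
  The open sets \<open>W n\<close> exhaust the region, so \<open>C\<close> lies in one of them. A power \<open>k \<ge> 2 * n\<close> moves \<open>W n\<close>
  into \<open>beyond n\<close>, which is disjoint from \<open>W n\<close>.
\<close>

lemma region_properly_discontinuous: "acts_properly_discontinuously X g region"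
  unfolding acts_properly_discontinuously_def
proof (intro allI impI, elim conjE)
  fix C assume C: "compact C" "C \<subseteq> region"
  define W where "W n = beyond (- int n) - insert (orbit (int n)) (beyond (int n))" for n :: nat
  have Wmono: "W m \<subseteq> W n" if "m \<le> n" for m n
    using that beyond_antimono[of "- int n" "- int m"] beyond_antimono[of "int m" "int n"]
      beyond_nested_insert[of "int m" "int n"]
    by (cases "m = n") (auto simp: W_def)
  have "\<exists>T. open T \<and> W n = X \<inter> T" for n
    using openin_diff[OF beyond_open beyond_closed] unfolding W_def openin_open by blast
  then obtain T where T: "\<And>n. open (T n)" "\<And>n. W n = X \<inter> T n"
    by metis
  have "C \<subseteq> (\<Union>n. T n)"
  proof
    fix w assume "w \<in> C"
    then obtain n where "w \<in> W n"
      using eventually_happens[OF region_eventually[of w]] C unfolding W_def by auto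
    then show "w \<in> (\<Union>n. T n)"
      using T by auto
  qed
  then obtain D where D: "finite D" "C \<subseteq> (\<Union>n\<in>D. T n)"
    by (rule compactE_image[OF C(1) T(1)])
  have "\<exists>n. \<forall>m\<in>D. m \<le> n"
    using D(1) by (simp add: finite_nat_set_iff_bounded_le)
  then obtain n where n: "\<And>m. m \<in> D \<Longrightarrow> m \<le> n"
    by blast
  have CX: "C \<subseteq> X"
    using C region_sub by blast
  have CW: "C \<subseteq> W n"
  proof
    fix w assume "w \<in> C"
    then obtain m where "m \<in> D" "w \<in> T m"
      using D by auto
    then show "w \<in> W n"
      using \<open>w \<in> C\<close> CX T(2)[of m] Wmono[OF n] by blast
  qed
  have far: False if "c \<in> C" "int_iter X g k c \<in> C" "2 * int n \<le> k" for c k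
  proof -
    have "c \<in> beyond (- int n)"
      using that CW by (auto simp: W_def)
    then have "int_iter X g k c \<in> beyond (- int n + k)"
      using int_iter_image_shift[OF hom, of beyond k "- int n"] beyond_sub image_beyond by auto
    also have "beyond (- int n + k) \<subseteq> beyond (int n)"
      using that by (intro beyond_antimono) auto
    finally show False
      using that CW by (auto simp: W_def)
  qed
  have "{k. int_iter X g k ` C \<inter> C \<noteq> {}} \<subseteq> {- (2 * int n)..2 * int n}"
  proof
    fix k assume "k \<in> {k. int_iter X g k ` C \<inter> C \<noteq> {}}"
    then obtain c where c: "c \<in> C" "int_iter X g k c \<in> C"
      by auto
    have "\<not> 2 * int n \<le> k"
      using far[OF c] by blast
    moreover have "\<not> 2 * int n \<le> - k"
      using far[OF c(2), of "- k"] int_iter_uminus[OF hom, of c k] c CX by auto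
    ultimately show "k \<in> {- (2 * int n)..2 * int n}"
      by auto
  qed
  then show "finite {k. int_iter X g k ` C \<inter> C \<noteq> {}}"
    by (rule finite_subset) simp
qed

lemma region_no_fixed_point:
  assumes w: "w \<in> region"
  shows "g w \<noteq> w"
proof
  assume "g w = w"
  then have "int_iter X g k ` {w} = {w}" for k
    using w region_sub by (intro int_iter_image_invariant[OF hom]) auto
  then have "{k. int_iter X g k ` {w} \<inter> {w} \<noteq> {}} = UNIV"
    by auto
  moreover have "finite {k. int_iter X g k ` {w} \<inter> {w} \<noteq> {}}"
    using region_properly_discontinuous w unfolding acts_properly_discontinuously_def
    by (metis compact_sing empty_subsetI insert_subset)
  ultimately show False
    by (simp add: infinite_UNIV_char_0)
qed

end

section \<open>Austro-boreal arcs and the components of D(g)\<close>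

text \<open>
  Both \<open>g\<close> and its inverse map the arc to a connected set that contains its ends, hence contains the
  arc.
\<close>

lemma homeomorphism_maps_arc_with_fixed_ends:
  assumes X: "dendrite X" and hom: "homeomorphism X X g h"
    and p: "arc p" "path_image p \<subseteq> X" and ends: "g (p 0) = p 0" "g (p 1) = p 1"
  shows "g ` path_image p = path_image p"
proof -
  have sub: "path_image p \<subseteq> k ` path_image p"
    if k: "homeomorphism X X k l" "k (p 0) = p 0" "k (p 1) = p 1" for k l
  proof (rule dendrite_arc_subset_connected[OF X p])
    show "connected (k ` path_image p)"
      using p homeomorphism_cont1[OF k(1)]
      by (intro connected_continuous_image connected_path_image) (auto intro: continuous_on_subset arc_imp_path)
    show "k ` path_image p \<subseteq> X"
      using p homeomorphism_image1[OF k(1)] by blast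
    have "p 0 \<in> path_image p" "p 1 \<in> path_image p"
      by (auto simp: path_image_def)
    then show "pathstart p \<in> k ` path_image p" "pathfinish p \<in> k ` path_image p"
      using k by (force simp: pathstart_def pathfinish_def)+
  qed
  have p01: "p 0 \<in> X" "p 1 \<in> X"
    using p by (auto simp: path_image_def)
  then have hends: "h (p 0) = p 0" "h (p 1) = p 1"
    using homeomorphism_apply1[OF hom] ends by metis+
  have "g ` path_image p \<subseteq> g ` h ` path_image p"
    using sub[OF homeomorphism_symD[OF hom] hends] by (rule image_mono)
  also have "\<dots> = path_image p"
    using p homeomorphism_apply2[OF hom] by (force simp: image_image)
  finally show ?thesis
    using sub[OF hom ends] by blast
qed

text \<open>
  Here \<open>f\<close> is the action of \<open>g\<close> in the parameter of the arc. The orbit of any interior parameter,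
  here \<open>1/2\<close>, is strictly increasing; its limits in both directions are fixed by \<open>f\<close>, so they are 1 and 0.
\<close>

lemma translated_arc_if_advancing:
  assumes X: "dendrite X" and hom: "homeomorphism X X g h"
    and p: "arc p" "path_image p \<subseteq> X" and ends: "g (p 0) = p 0" "g (p 1) = p 1"
    and f: "continuous_on {0..1} f" "\<And>t. t \<in> {0..1} \<Longrightarrow> f t \<in> {0..1} \<and> g (p t) = p (f t)"
    and adv: "\<And>t. t \<in> {0<..<1} \<Longrightarrow> t < f t"
  shows "\<exists>u. translated_arc X g h p u"
proof -
  have inj: "inj_on p {0..1}"
    using p by (simp add: arc_def)
  define S where "S = p ` {0<..<1}"
  have SX: "S \<subseteq> X"
    using p by (auto simp: S_def path_image_def)
  have "S = p ` {0..1} - p ` {0, 1}"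
  proof -
    have "{0<..<1::real} = {0..1} - {0, 1}"
      by auto
    then show ?thesis
      unfolding S_def using inj by (metis inj_on_image_set_diff Diff_subset atLeastAtMost_iff
          empty_subsetI insert_subset order_refl zero_le_one)
  qed
  then have S: "S = path_image p - {p 0, p 1}"
    by (simp add: path_image_def)
  have p01: "{p 0, p 1} \<subseteq> X"
    using p by (auto simp: path_image_def)
  have "g ` S = g ` path_image p - g ` {p 0, p 1}"
    unfolding S using p p01 by (intro inj_on_image_set_diff[OF homeomorphism_self_inj[OF hom]]) auto
  also have "\<dots> = S"
    using homeomorphism_maps_arc_with_fixed_ends[OF X hom p ends] ends by (simp add: S)
  finally have gS: "g ` S = S" .
  define x where "x = p (1/2)"
  have x: "x \<in> S" "x \<in> X"
    using SX by (auto simp: x_def S_def)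
  have "\<exists>t\<in>{0<..<1}. int_iter X g n x = p t" for n
  proof -
    have "int_iter X g n x \<in> S"
      using int_iter_image_invariant[OF hom SX gS, of n] x by blast
    then show ?thesis
      by (auto simp: S_def)
  qed
  then obtain u where u: "\<And>n. u n \<in> {0<..<1}" "\<And>n. int_iter X g n x = p (u n)"
    by metis
  then have u01: "0 < u n" "u n < 1" "u n \<in> {0..1}" for n
    by (auto simp: less_imp_le)
  have gu: "g (p (u n)) = p (u (n + 1))" for n
    using int_iter_Suc[OF hom x(2)] u by metis
  have fu: "f (u n) = u (n + 1)" for n
  proof (rule inj_onD[OF inj])
    show "p (f (u n)) = p (u (n + 1))"
      using f(2)[OF u01(3)] gu by metis
  qed (use f(2)[OF u01(3)] u01 in auto)
  have u_less: "u n < u (n + 1)" for n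
    using adv[OF u(1)] fu by metis
  have fix01: "L \<le> 0 \<or> 1 \<le> L" if "f L = L" for L
    using adv[of L] that by fastforce
  have flim: "(\<lambda>n. f (v n)) \<longlonglongrightarrow> f L" if "v \<longlonglongrightarrow> L" "\<And>n. v n \<in> {0..1}" for v :: "nat \<Rightarrow> real" and L
  proof (rule continuous_on_tendsto_compose[OF f(1) that(1)])
    show "L \<in> {0..1}"
      using closed_sequentially[OF closed_atLeastAtMost, of v 0 1 L] that by blast
  qed (use that in simp)
  have "(\<lambda>n. u (int n)) \<longlonglongrightarrow> 1"
  proof -
    have mono: "incseq (\<lambda>n. u (int n))"
    proof (rule incseq_SucI)
      show "u (int n) \<le> u (int (Suc n))" for n
        using u_less[of "int n"] by (simp add: add.commute)
    qed
    then obtain L where L: "(\<lambda>n. u (int n)) \<longlonglongrightarrow> L" "\<And>n. u (int n) \<le> L"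
      using incseq_convergent[OF mono, of 1] u01(2) less_imp_le by blast
    have "(\<lambda>n. u (int (Suc n))) \<longlonglongrightarrow> L"
      using L(1) by (rule LIMSEQ_Suc)
    then have "(\<lambda>n. f (u (int n))) \<longlonglongrightarrow> L"
      by (simp add: fu add.commute)
    then have "f L = L"
      using flim[OF L(1) u01(3)] LIMSEQ_unique by blast
    moreover have "0 < L"
      using L(2)[of 0] u01(1)[of 0] by simp
    moreover have "L \<le> 1"
      using LIMSEQ_le_const2[OF L(1)] u01(2) less_imp_le by blast
    ultimately show ?thesis
      using fix01[of L] L(1) by auto
  qed
  moreover have "(\<lambda>n. u (- int n)) \<longlonglongrightarrow> 0"
  proof -
    have step: "u (- int (Suc n)) < u (- int n)" for n
      using u_less[of "- int (Suc n)"] by simp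
    have mono: "decseq (\<lambda>n. u (- int n))"
      by (rule decseq_SucI) (use step less_imp_le in blast)
    then obtain L where L: "(\<lambda>n. u (- int n)) \<longlonglongrightarrow> L" "\<And>n. L \<le> u (- int n)"
      using decseq_convergent[OF mono, of 0] u01(1) less_imp_le by blast
    have L': "(\<lambda>n. u (- int (Suc n))) \<longlonglongrightarrow> L"
      using L(1) by (rule LIMSEQ_Suc)
    have "f (u (- int (Suc n))) = u (- int n)" for n
      using fu[of "- int (Suc n)"] by simp
    then have "(\<lambda>n. f (u (- int (Suc n)))) \<longlonglongrightarrow> L"
      using L(1) by simp
    then have "f L = L"
      using flim[OF L' u01(3)] LIMSEQ_unique by blast
    moreover have "L < 1"
      using L(2)[of 0] u01(2)[of 0] by simp
    moreover have "0 \<le> L"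
      using LIMSEQ_le_const[OF L(1)] u01(1) less_imp_le by blast
    ultimately show ?thesis
      using fix01[of L] L(1) by auto
  qed
  ultimately have "translated_arc X g h p u"
    using X hom p ends u01 u_less gu by unfold_locales auto
  then show ?thesis by blast
qed

text \<open>
  The function \<open>f t - t\<close> does not vanish on the open interval, so it has constant sign there. If it is
  negative, the arc is traversed in the opposite direction; this is why the conclusion only fixes the
  unordered pair of ends.
\<close>

lemma austro_boreal_translated_arc:
  assumes X: "dendrite X" and hom: "homeomorphism X X g h" and I: "austro_boreal X g x y I"
  obtains p u where "translated_arc X g h p u" "path_image p = I" "{p 0, p 1} = {x, y}"
proof -
  obtain p where p: "arc p" "path_image p = I" "p 0 = x" "p 1 = y" and IX: "I \<subseteq> X"
    using I unfolding austro_boreal_def arc_between_def pathstart_def pathfinish_def by blast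
  have fx: "Fix X g \<inter> I = {x, y}"
    using I by (simp add: austro_boreal_def)
  have ends: "g (p 0) = p 0" "g (p 1) = p 1"
    using fx p by (auto simp: Fix_def)
  have pX: "path_image p \<subseteq> X"
    using p IX by simp
  obtain k where k: "homeomorphism {0..1} (path_image p) p k"
    using homeomorphism_arc[OF p(1)] by blast
  define f where "f t = k (g (p t))" for t
  have gI: "g ` path_image p = path_image p"
    by (rule homeomorphism_maps_arc_with_fixed_ends[OF X hom p(1) pX ends])
  have gp: "g (p t) \<in> path_image p" if "t \<in> {0..1}" for t
    using gI that by (auto simp: path_image_def)
  have f: "f t \<in> {0..1} \<and> g (p t) = p (f t)" if "t \<in> {0..1}" for t
    using gp[OF that] k homeomorphism_image2[OF k] homeomorphism_apply2[OF k] unfolding f_def by auto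
  have contf: "continuous_on {0..1} f"
    unfolding f_def
  proof (rule continuous_on_compose2[OF homeomorphism_cont2[OF k]])
    show "continuous_on {0..1} (\<lambda>t. g (p t))"
      using continuous_on_compose2[OF homeomorphism_cont1[OF hom] homeomorphism_cont1[OF k]] pX
      by (simp add: path_image_def)
  qed (use gp in auto)
  have nofix: "f t - t \<noteq> 0" if t: "t \<in> {0<..<1}" for t
  proof
    assume "f t - t = 0"
    then have "g (p t) = p t"
      using f[of t] t by auto
    moreover have "p t \<in> I"
      using t p(2) by (auto simp: path_image_def)
    ultimately have "p t \<in> {p 0, p 1}"
      using fx IX p by (auto simp: Fix_def)
    then show False
      using t p(1) inj_on_eq_iff[of p "{0..1}" t 0] inj_on_eq_iff[of p "{0..1}" t 1]
      by (auto simp: arc_def)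
  qed
  have con: "connected ((\<lambda>t. f t - t) ` {0<..<1})"
    by (intro connected_continuous_image continuous_intros continuous_on_subset[OF contf]) auto
  consider "\<And>t. t \<in> {0<..<1} \<Longrightarrow> t < f t" | "\<And>t. t \<in> {0<..<1} \<Longrightarrow> f t < t"
  proof (cases "(\<forall>t\<in>{0<..<1}. t < f t) \<or> (\<forall>t\<in>{0<..<1}. f t < t)")
    case False
    then obtain a b where ab: "a \<in> {0<..<1}" "b \<in> {0<..<1}" "f a - a \<le> 0" "0 \<le> f b - b"
      by force
    then have "0 \<in> (\<lambda>t. f t - t) ` {0<..<1}"
      using connected_contains_Icc[OF con, of "f a - a" "f b - b"] by force
    then show ?thesis
      using nofix by force
  qed (use that in blast)
  then show thesis
  proof cases
    case 1
    then show thesis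
    proof -
      have "\<exists>u. translated_arc X g h p u"
        by (rule translated_arc_if_advancing[OF X hom p(1) pX ends contf]) (fact f 1)+
      then obtain u where "translated_arc X g h p u"
        by blast
      then show thesis
        using p(2-4) by (intro that[of p u]) simp_all
    qed
  next
    case 2
    let ?p = "reversepath p" and ?f = "\<lambda>t. 1 - f (1 - t)"
    have "\<exists>u. translated_arc X g h ?p u"
    proof (rule translated_arc_if_advancing[OF X hom])
      show "continuous_on {0..1} ?f"
        by (intro continuous_intros continuous_on_compose2[OF contf]) auto
      show "t < ?f t" if "t \<in> {0<..<1}" for t
        using 2[of "1 - t"] that by simp
      show "?f t \<in> {0..1} \<and> g (?p t) = ?p (?f t)" if "t \<in> {0..1}" for t
        using f[of "1 - t"] that by (simp add: reversepath_def)
      show "arc ?p" "path_image ?p \<subseteq> X"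
        using p pX by (auto intro: arc_reversepath)
      show "g (?p 0) = ?p 0" "g (?p 1) = ?p 1"
        using ends by (auto simp: reversepath_def)
    qed
    then obtain u where "translated_arc X g h ?p u"
      by blast
    moreover have "path_image ?p = I" "{?p 0, ?p 1} = {x, y}"
      using p path_image_reversepath[of p] by (auto simp: reversepath_def)
    ultimately show thesis
      by (rule that)
  qed
qed

lemma (in translated_arc) O_arc_eq_region:
  assumes I: "path_image p = I" "{p 0, p 1} = {x, y}"
  shows "O_arc X x y I = region" "I - {x, y} \<subseteq> region"
proof -
  show sub: "I - {x, y} \<subseteq> region"
  proof
    fix w assume "w \<in> I - {x, y}"
    then obtain t where t: "t \<in> {0..1}" "w = p t" "w \<noteq> p 0" "w \<noteq> p 1"
      using I by (force simp: path_image_def)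
    then have "t \<noteq> 0" "t \<noteq> 1"
      by auto
    then have "t \<in> {0<..<1}"
      using t(1) by auto
    then show "w \<in> region"
      using arc_interior_subset_region t(2) by blast
  qed
  have comp: "region \<in> components (X - {x, y})"
    unfolding region_def I(2)[symmetric] using orbit_in_X orbit_ne_ends by (intro componentsI) auto
  have orbit: "orbit 0 \<in> I - {x, y}"
    using orbit_ne_ends u01[of 0] unfolding I(2)[symmetric] I(1)[symmetric] by (auto simp: orbit_def path_image_def)
  show "O_arc X x y I = region"
    unfolding O_arc_def
  proof (rule the_equality)
    show "region \<in> components (X - {x, y}) \<and> I - {x, y} \<subseteq> region"
      using comp sub by simp
    fix U assume U: "U \<in> components (X - {x, y}) \<and> I - {x, y} \<subseteq> U"
    then have "orbit 0 \<in> U \<inter> region"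
      using orbit sub by blast
    then show "U = region"
      using U comp components_eq by blast
  qed
qed

definition zones :: "'a::metric_space set \<Rightarrow> ('a \<Rightarrow> 'a) \<Rightarrow> 'a set set" where
  "zones X g = {O_arc X x y I | x y I. austro_boreal X g x y I}"

lemma D_set_zones: "D_set X g = \<Union> (zones X g)"
  by (simp add: D_set_def zones_def)

context
  fixes X :: "'a::metric_space set" and g h :: "'a \<Rightarrow> 'a"
  assumes X: "dendrite X" and hom: "homeomorphism X X g h"
begin

lemma interior_subset_O_arc:
  assumes "austro_boreal X g x y I"
  shows "I - {x, y} \<subseteq> O_arc X x y I"
proof -
  obtain p u where pu: "translated_arc X g h p u" "path_image p = I" "{p 0, p 1} = {x, y}"
    using austro_boreal_translated_arc[OF X hom assms] by blast
  interpret translated_arc X g h p u by fact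
  show ?thesis
    using O_arc_eq_region[OF pu(2,3)] by simp
qed

text \<open>
  The last part holds because the only boundary points a zone can have are the ends of its arc, which
  are fixed.
\<close>

lemma zone:
  assumes U: "U \<in> zones X g"
  shows zone_open: "openin (top_of_set X) U" and zone_connected: "connected U"
    and zone_invariant: "g ` U = U" and zone_fixfree: "w \<in> U \<Longrightarrow> g w \<noteq> w"
    and zone_cocompact: "acts_cocompactly X g U"
    and zone_properly_discontinuous: "acts_properly_discontinuously X g U"
    and zone_escape: "connected S \<Longrightarrow> S \<subseteq> X \<Longrightarrow> S \<inter> U \<noteq> {} \<Longrightarrow> \<not> S \<subseteq> U \<Longrightarrow> \<exists>e\<in>S. g e = e"
proof -
  obtain x y I where I: "austro_boreal X g x y I" "U = O_arc X x y I"
    using U by (auto simp: zones_def)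
  obtain p u where pu: "translated_arc X g h p u" "path_image p = I" "{p 0, p 1} = {x, y}"
    using austro_boreal_translated_arc[OF X hom I(1)] by blast
  interpret translated_arc X g h p u by fact
  have U: "U = region"
    using O_arc_eq_region[OF pu(2,3)] I by simp
  show "openin (top_of_set X) U" "connected U" "g ` U = U" "acts_cocompactly X g U"
    "acts_properly_discontinuously X g U" "w \<in> U \<Longrightarrow> g w \<noteq> w"
    unfolding U by (fact region_open region_connected image_region region_cocompact region_properly_discontinuous
        region_no_fixed_point)+
  show "\<exists>e\<in>S. g e = e" if S: "connected S" "S \<subseteq> X" "S \<inter> U \<noteq> {}" "\<not> S \<subseteq> U"
  proof -
    have "p 0 \<in> S \<or> p 1 \<in> S"
      using region_absorbs[OF S(1,2)] S(3,4) unfolding U by blast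
    then show ?thesis
      using ends by blast
  qed
qed

lemma zones_subset: "U \<in> zones X g \<Longrightarrow> U \<subseteq> X"
  using zone_open openin_imp_subset by blast

text \<open>
  A zone contains no fixed point, so it cannot leave another zone that it meets.
\<close>

lemma zones_disjoint:
  assumes "U \<in> zones X g" "V \<in> zones X g" "U \<inter> V \<noteq> {}"
  shows "U = V"
proof -
  have "V \<subseteq> U" if "U \<in> zones X g" "V \<in> zones X g" "U \<inter> V \<noteq> {}" for U V
    using that zone_escape[of U V] zone_fixfree[of V] zone_connected[of V] zones_subset[of V] by blast
  then show ?thesis
    using assms by (metis Int_commute subset_antisym)
qed

lemma D_set_subset: "D_set X g \<subseteq> X"
  unfolding D_set_zones using zones_subset by blast

lemma D_set_open: "openin (top_of_set X) (D_set X g)"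
  unfolding D_set_zones using zone_open by (intro openin_Union) auto

lemma D_set_no_fixed_point: "w \<in> D_set X g \<Longrightarrow> g w \<noteq> w"
  unfolding D_set_zones using zone_fixfree by blast

lemma D_set_invariant: "g ` D_set X g = D_set X g"
proof -
  have "g ` D_set X g = (\<Union>U\<in>zones X g. g ` U)"
    unfolding D_set_zones by blast
  also have "\<dots> = D_set X g"
    unfolding D_set_zones using zone_invariant by simp
  finally show ?thesis .
qed

lemma component_D_set_zone:
  assumes U: "U \<in> components (D_set X g)"
  shows "U \<in> zones X g"
proof -
  obtain w where w: "w \<in> U"
    using in_components_nonempty[OF U] by blast
  have UD: "U \<subseteq> D_set X g"
    by (rule in_components_subset[OF U])
  then obtain V where V: "V \<in> zones X g" "w \<in> V"
    using w by (auto simp: D_set_zones)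
  have "V \<subseteq> D_set X g"
    using V by (auto simp: D_set_zones)
  then have "V \<subseteq> U"
    using components_maximal[OF U zone_connected[OF V(1)]] V(2) w by blast
  moreover have "U \<subseteq> V"
    using zone_escape[OF V(1) in_components_connected[OF U]] UD D_set_subset D_set_no_fixed_point V(2) w
    by blast
  ultimately show ?thesis
    using V(1) by simp
qed

text \<open>
  A compact subset of \<open>D(g)\<close> meets only finitely many zones, in compact pieces, and each zone is
  invariant.
\<close>

lemma D_set_properly_discontinuous: "acts_properly_discontinuously X g (D_set X g)"
  unfolding acts_properly_discontinuously_def
proof (intro allI impI, elim conjE)
  fix C assume C: "compact C" "C \<subseteq> D_set X g"
  have CX: "C \<subseteq> X"
    using C D_set_subset by blast
  have "\<exists>T. open T \<and> U = X \<inter> T" if "U \<in> zones X g" for U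
    using zone_open[OF that] by (simp add: openin_open)
  then obtain T where T: "\<And>U. U \<in> zones X g \<Longrightarrow> open (T U)" "\<And>U. U \<in> zones X g \<Longrightarrow> U = X \<inter> T U"
    by metis
  have "C \<subseteq> (\<Union>U\<in>zones X g. T U)"
    using C(2) T(2) unfolding D_set_zones by blast
  obtain F where F: "F \<subseteq> zones X g" "finite F" "C \<subseteq> (\<Union>U\<in>F. T U)"
  proof (rule compactE_image[OF C(1), of "zones X g" T])
    show "C \<subseteq> (\<Union>U\<in>zones X g. T U)"
      by fact
  qed (use T(1) in blast)+
  have fin: "finite {k. int_iter X g k ` (C \<inter> U) \<inter> (C \<inter> U) \<noteq> {}}" if U: "U \<in> zones X g" for U
  proof -
    \<comment> \<open>the other zones are open, so \<open>C \<inter> U\<close> is closed in \<open>C\<close>\<close>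
    define G where "G = (\<Union>V\<in>zones X g - {U}. T V)"
    have "open G"
      using T(1) by (auto simp: G_def)
    moreover have "C \<inter> U = C - G"
    proof
      show "C \<inter> U \<subseteq> C - G"
        using CX T(2) zones_disjoint[OF U] unfolding G_def by blast
      show "C - G \<subseteq> C \<inter> U"
        using C(2) T(2) unfolding D_set_zones G_def by blast
    qed
    ultimately have "compact (C \<inter> U)"
      using compact_diff[OF C(1)] by simp
    then show ?thesis
      using zone_properly_discontinuous[OF U] unfolding acts_properly_discontinuously_def by blast
  qed
  have "{k. int_iter X g k ` C \<inter> C \<noteq> {}} \<subseteq> (\<Union>U\<in>F. {k. int_iter X g k ` (C \<inter> U) \<inter> (C \<inter> U) \<noteq> {}})"
  proof
    fix k assume "k \<in> {k. int_iter X g k ` C \<inter> C \<noteq> {}}"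
    then obtain c where c: "c \<in> C" "int_iter X g k c \<in> C"
      by blast
    then obtain U where U: "U \<in> F" "c \<in> T U"
      using F by blast
    then have UZ: "U \<in> zones X g"
      using F by blast
    then have "c \<in> U"
      using T(2)[OF UZ] U CX c by blast
    then have "int_iter X g k c \<in> U"
      using int_iter_image_invariant[OF hom zones_subset[OF UZ] zone_invariant[OF UZ], of k] by blast
    then show "k \<in> (\<Union>U\<in>F. {k. int_iter X g k ` (C \<inter> U) \<inter> (C \<inter> U) \<noteq> {}})"
      using U c \<open>c \<in> U\<close> by blast
  qed
  moreover have "finite (\<Union>U\<in>F. {k. int_iter X g k ` (C \<inter> U) \<inter> (C \<inter> U) \<noteq> {}})"
    using F fin by blast
  ultimately show "finite {k. int_iter X g k ` C \<inter> C \<noteq> {}}"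
    by (rule finite_subset)
qed

section \<open>The components of K(g)\<close>

lemma K_set_closed: "closedin (top_of_set X) (K_set X g)"
  unfolding K_set_def using D_set_open by (intro closedin_diff) auto

lemma K_set_compact: "compact (K_set X g)"
  using K_set_closed dendriteD(1)[OF X] closedin_compact by blast

lemma K_set_subset: "K_set X g \<subseteq> X"
  by (auto simp: K_set_def)

lemma fixed_point_in_K_set: "y \<in> X \<Longrightarrow> g y = y \<Longrightarrow> y \<in> K_set X g"
  using D_set_no_fixed_point by (auto simp: K_set_def)

lemma K_set_invariant: "g ` K_set X g = K_set X g"
proof -
  have "g ` K_set X g = g ` X - g ` D_set X g"
    unfolding K_set_def using D_set_subset
    by (intro inj_on_image_set_diff[OF homeomorphism_self_inj[OF hom]]) auto
  then show ?thesis
    using D_set_invariant homeomorphism_image1[OF hom] by (simp add: K_set_def)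
qed

lemma closed_fixed_times:
  assumes p: "continuous_on {a..b::real} p" "p ` {a..b} \<subseteq> X"
  shows "compact {t \<in> {a..b}. g (p t) = p t}"
proof -
  have "continuous_on {a..b} (\<lambda>t. dist (g (p t)) (p t))"
    using p by (intro continuous_intros continuous_on_compose2[OF homeomorphism_cont1[OF hom] p(1)]) auto
  then have "closed ({a..b} \<inter> (\<lambda>t. dist (g (p t)) (p t)) -` {0})"
    by (intro continuous_closed_preimage) auto
  then have "compact ({a..b} \<inter> ({a..b} \<inter> (\<lambda>t. dist (g (p t)) (p t)) -` {0}))"
    by (intro compact_Int_closed) auto
  moreover have "{a..b} \<inter> ({a..b} \<inter> (\<lambda>t. dist (g (p t)) (p t)) -` {0}) = {t \<in> {a..b}. g (p t) = p t}"
    by auto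
  ultimately show ?thesis
    by simp
qed

text \<open>
  A path from a point of \<open>Y\<close> to a fixed point of \<open>g\<close> in \<open>X\<close>, cut off at the first fixed point \<open>q r\<close> on it.
  Before \<open>r\<close> it cannot enter a zone, since it would have crossed a fixed point on the way in.
\<close>

lemma component_K_set_fixed_point:
  assumes Y: "Y \<in> components (K_set X g)"
  shows "\<exists>y\<in>Y. g y = y"
proof -
  obtain a where a: "a \<in> Y"
    using in_components_nonempty[OF Y] by blast
  have YK: "Y \<subseteq> K_set X g"
    by (rule in_components_subset[OF Y])
  obtain e where e: "e \<in> X" "g e = e"
    using dendrite_homeomorphism_fixed_point[OF X hom] by blast
  have "path_connected X"
    by (rule openin_connected_imp_path_connected[OF dendriteD(5)[OF X] openin_subtopology_self dendriteD(2)[OF X]])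
  then have "\<exists>q. path q \<and> path_image q \<subseteq> X \<and> pathstart q = a \<and> pathfinish q = e"
    unfolding path_connected_def using a e YK K_set_subset by blast
  then obtain q where q: "path q" "path_image q \<subseteq> X" "q 0 = a" "q 1 = e"
    by (auto simp: pathstart_def pathfinish_def)
  have contq: "continuous_on {0..1} q" and qX: "q ` {0..1} \<subseteq> X"
    using q by (auto simp: path_def path_image_def)
  have "1 \<in> {t \<in> {0..1}. g (q t) = q t}"
    using q e by simp
  then obtain r where r: "r \<in> {0..1}" "g (q r) = q r" "\<And>t. t \<in> {0..1} \<Longrightarrow> g (q t) = q t \<Longrightarrow> r \<le> t"
    using compact_attains_inf[OF closed_fixed_times[OF contq qX]] by (metis (mono_tags, lifting) empty_iff mem_Collect_eq)
  have con: "connected (q ` {0..t})" and sub: "q ` {0..t} \<subseteq> X" if "t \<le> 1" for t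
    using that qX by (auto intro!: connected_continuous_image continuous_on_subset[OF contq])
  have "q t \<in> K_set X g" if t: "t \<in> {0..r}" for t
  proof (rule ccontr)
    assume "q t \<notin> K_set X g"
    moreover have "q t \<in> X"
      using t r qX by auto
    ultimately obtain U where U: "U \<in> zones X g" "q t \<in> U"
      by (auto simp: K_set_def D_set_zones)
    have "t \<noteq> r"
      using zone_fixfree[OF U] r by blast
    have "q 0 \<notin> U"
      using a YK U q by (auto simp: K_set_def D_set_zones)
    moreover have "q 0 \<in> q ` {0..t}" "q t \<in> q ` {0..t}"
      using t by auto
    moreover have "t \<le> 1"
      using t r by auto
    ultimately have "\<exists>e\<in>q ` {0..t}. g e = e"
      using zone_escape[OF U(1) con sub, of t] U(2) by blast
    then obtain s where "s \<in> {0..t}" "g (q s) = q s"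
      by blast
    then show False
      using r(3)[of s] t \<open>t \<noteq> r\<close> \<open>t \<le> 1\<close> by auto
  qed
  then have "q ` {0..r} \<subseteq> K_set X g"
    by blast
  moreover have "a \<in> q ` {0..r}" "q r \<in> q ` {0..r}"
    using q(3) r(1) by auto
  ultimately have "q ` {0..r} \<subseteq> Y"
    using components_maximal[OF Y con, of r] a r(1) by auto
  then show ?thesis
    using r \<open>q r \<in> q ` {0..r}\<close> by blast
qed

text \<open>
  A non-fixed point \<open>p t\<close> lies in a gap of the fixed-point set along the arc. With its ends, the last
  fixed point before \<open>p t\<close> and the first one after it, the gap is an austro-boreal arc, which puts \<open>p t\<close>
  into \<open>D(g)\<close>.
\<close>

lemma arc_in_K_set_fixed:
  assumes p: "arc p" "path_image p \<subseteq> K_set X g" and ends: "g (p 0) = p 0" "g (p 1) = p 1"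
    and t: "t \<in> {0..1}"
  shows "g (p t) = p t"
proof (rule ccontr)
  assume nofix: "g (p t) \<noteq> p t"
  have contp: "continuous_on {0..1} p" and inj: "inj_on p {0..1}"
    using p by (auto simp: arc_def path_def)
  have pK: "p ` {0..1} \<subseteq> K_set X g"
    using p by (simp add: path_image_def)
  have cont: "continuous_on {a..b} p" "p ` {a..b} \<subseteq> X" if "0 \<le> a" "b \<le> 1" for a b
  proof -
    have "{a..b} \<subseteq> {0..1}"
      using that by auto
    then show "continuous_on {a..b} p" "p ` {a..b} \<subseteq> X"
      using pK K_set_subset continuous_on_subset[OF contp] by blast+
  qed
  have "0 \<in> {s \<in> {0..t}. g (p s) = p s}"
    using t ends by simp
  then obtain a where a: "a \<in> {0..t}" "g (p a) = p a" "\<And>s. s \<in> {0..t} \<Longrightarrow> g (p s) = p s \<Longrightarrow> s \<le> a"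
    using compact_attains_sup[OF closed_fixed_times[OF cont, of 0 t]] t
    by (metis (mono_tags, lifting) atLeastAtMost_iff empty_iff mem_Collect_eq order_refl)
  have "1 \<in> {s \<in> {t..1}. g (p s) = p s}"
    using t ends by simp
  then obtain b where b: "b \<in> {t..1}" "g (p b) = p b" "\<And>s. s \<in> {t..1} \<Longrightarrow> g (p s) = p s \<Longrightarrow> b \<le> s"
    using compact_attains_inf[OF closed_fixed_times[OF cont, of t 1]] t
    by (metis (mono_tags, lifting) atLeastAtMost_iff empty_iff mem_Collect_eq order_refl)
  have "a \<noteq> t" "b \<noteq> t"
    using nofix a b by auto
  then have ab: "0 \<le> a" "a < t" "t < b" "b \<le> 1"
    using a b by auto
  define I where "I = p ` {a..b}"
  have ne: "p a \<noteq> p t" "p b \<noteq> p t" "p a \<noteq> p b"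
    using inj_on_eq_iff[OF inj] ab by auto
  have "Fix X g \<inter> I \<subseteq> {p a, p b}"
  proof
    fix w assume "w \<in> Fix X g \<inter> I"
    then obtain s where s: "s \<in> {a..b}" "w = p s" "g (p s) = p s"
      by (auto simp: I_def Fix_def)
    show "w \<in> {p a, p b}"
    proof (cases "s \<le> t")
      case True
      then show ?thesis
        using a(3)[of s] s ab by auto
    next
      case False
      then show ?thesis
        using b(3)[of s] s ab by auto
    qed
  qed
  moreover have "p a \<in> Fix X g \<inter> I" "p b \<in> Fix X g \<inter> I"
    using a b ab cont[of a b] by (auto simp: I_def Fix_def)
  moreover have "arc_between X (p a) (p b) I"
    unfolding arc_between_def
    using arc_path_segment[OF p(1), of a b] path_image_segment[of a b p] ab cont[of a b]
    by (auto simp: I_def intro!: exI[of _ "path_segment a b p"])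
  ultimately have I: "austro_boreal X g (p a) (p b) I"
    using ne by (auto simp: austro_boreal_def)
  have "p t \<in> I - {p a, p b}"
    using ab ne by (auto simp: I_def)
  then have "p t \<in> D_set X g"
    using interior_subset_O_arc[OF I] I by (auto simp: D_set_def)
  then show False
    using pK t unfolding K_set_def by blast
qed

lemma component_K_set_connected_Fix:
  assumes Y: "Y \<in> components (K_set X g)"
  shows "connected (Fix X g \<inter> Y)"
  unfolding connected_iff_connected_component
proof (intro ballI)
  fix a b assume a: "a \<in> Fix X g \<inter> Y" and b: "b \<in> Fix X g \<inter> Y"
  show "connected_component (Fix X g \<inter> Y) a b"
  proof (cases "a = b")
    case True
    then show ?thesis
      using a by simp
  next
    case False
    have YK: "Y \<subseteq> K_set X g"
      by (rule in_components_subset[OF Y])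
    have "a \<in> X" "b \<in> X"
      using a b by (auto simp: Fix_def)
    then obtain p where p: "arc p" "path_image p \<subseteq> X" "p 0 = a" "p 1 = b"
      using dendrite_arc_exists[OF X _ _ False] by blast
    have pY: "path_image p \<subseteq> Y"
      using a b p YK K_set_subset in_components_connected[OF Y]
      by (intro dendrite_arc_subset_connected[OF X p(1,2)]) (auto simp: pathstart_def pathfinish_def)
    have "g (p t) = p t" if "t \<in> {0..1}" for t
    proof (rule arc_in_K_set_fixed[OF p(1) _ _ _ that])
      show "path_image p \<subseteq> K_set X g"
        using pY YK by blast
      show "g (p 0) = p 0" "g (p 1) = p 1"
        using a b p by (simp_all add: Fix_def)
    qed
    then have "path_image p \<subseteq> Fix X g \<inter> Y"
      using pY p(2) by (auto simp: Fix_def path_image_def)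
    moreover have "a \<in> path_image p" "b \<in> path_image p"
      using p by (auto simp: path_image_def)
    moreover have "connected (path_image p)"
      using p by (simp add: arc_imp_path connected_path_image)
    ultimately show ?thesis
      unfolding connected_component_def by blast
  qed
qed

text \<open>
  Both \<open>g\<close> and its inverse permute the components of \<open>K(g)\<close>, and they keep \<open>Y\<close> because it contains a fixed
  point.
\<close>

lemma component_K_set_invariant:
  assumes Y: "Y \<in> components (K_set X g)"
  shows "g ` Y = Y"
proof -
  obtain e where e: "e \<in> Y" "g e = e"
    using component_K_set_fixed_point[OF Y] by blast
  have YK: "Y \<subseteq> K_set X g"
    by (rule in_components_subset[OF Y])
  have sub: "k ` Y \<subseteq> Y" if k: "homeomorphism X X k l" "k e = e" "k ` K_set X g = K_set X g" for k l
  proof (rule components_maximal[OF Y])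
    show "connected (k ` Y)"
      using in_components_connected[OF Y] YK K_set_subset homeomorphism_cont1[OF k(1)]
      by (intro connected_continuous_image) (auto intro: continuous_on_subset)
    show "k ` Y \<subseteq> K_set X g"
      using YK k(3) by blast
    show "Y \<inter> k ` Y \<noteq> {}"
      using e(1) k(2) by force
  qed
  have hg: "h (g y) = y" if "y \<in> K_set X g" for y
    using that K_set_subset homeomorphism_apply1[OF hom] by blast
  have he: "h e = e"
    using hg[of e] e YK by auto
  have hK: "h ` K_set X g = K_set X g"
  proof -
    have "h ` K_set X g = h ` g ` K_set X g"
      using K_set_invariant by simp
    also have "\<dots> = K_set X g"
      using hg by (force simp: image_image)
    finally show ?thesis .
  qed
  have "Y = g ` h ` Y"
    using YK K_set_subset homeomorphism_apply2[OF hom] by (force simp: image_image subset_iff)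
  also have "\<dots> \<subseteq> g ` Y"
    using sub[OF homeomorphism_symD[OF hom] he hK] by (rule image_mono)
  finally show ?thesis
    using sub[OF hom e(2) K_set_invariant] by blast
qed

lemma component_K_set_sub_dendrite:
  assumes Y: "Y \<in> components (K_set X g)"
  shows "sub_dendrite X Y"
proof -
  have "closedin (top_of_set X) Y"
    using closedin_trans[OF closedin_component[OF Y] K_set_closed] .
  then show ?thesis
    unfolding sub_dendrite_def using in_components_nonempty[OF Y] in_components_connected[OF Y] by blast
qed

end

theorem proposition10p6:
  fixes X :: "'a::metric_space set" and g h :: "'a \<Rightarrow> 'a"
  assumes "dendrite X"
    and "homeomorphism X X g h"
  shows
    "D_set X g \<union> K_set X g = X \<and> D_set X g \<inter> K_set X g = {} \<and>
     (openin (top_of_set X) (D_set X g) \<and> g ` D_set X g = D_set X g \<and>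
      acts_properly_discontinuously X g (D_set X g) \<and>
      K_set X g \<noteq> {} \<and> compact (K_set X g) \<and> g ` K_set X g = K_set X g) \<and>
     ((\<forall>U \<in> components (D_set X g). \<exists>x y I. austro_boreal X g x y I \<and> U = O_arc X x y I) \<and>
      (\<forall>x y I. austro_boreal X g x y I \<longrightarrow> acts_cocompactly X g (O_arc X x y I))) \<and>
     (\<Union> (components (K_set X g)) = K_set X g \<and> disjoint (components (K_set X g)) \<and>
      (\<forall>Y \<in> components (K_set X g).
         sub_dendrite X Y \<and> g ` Y = Y \<and> Fix X g \<inter> Y \<noteq> {} \<and> connected (Fix X g \<inter> Y)))"
proof (intro conjI ballI allI impI)
  note X = assms(1) and hom = assms(2)
  show "D_set X g \<union> K_set X g = X"
    using D_set_subset[OF X hom] by (auto simp: K_set_def)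
  show "D_set X g \<inter> K_set X g = {}"
    by (auto simp: K_set_def)
  show "openin (top_of_set X) (D_set X g)"
    by (rule D_set_open[OF X hom])
  show "g ` D_set X g = D_set X g"
    by (rule D_set_invariant[OF X hom])
  show "acts_properly_discontinuously X g (D_set X g)"
    by (rule D_set_properly_discontinuous[OF X hom])
  show "K_set X g \<noteq> {}"
    using dendrite_homeomorphism_fixed_point[OF X hom] fixed_point_in_K_set[OF X hom] by blast
  show "compact (K_set X g)"
    by (rule K_set_compact[OF X hom])
  show "g ` K_set X g = K_set X g"
    by (rule K_set_invariant[OF X hom])
  show "\<exists>x y I. austro_boreal X g x y I \<and> U = O_arc X x y I" if "U \<in> components (D_set X g)" for U
    using component_D_set_zone[OF X hom that] by (auto simp: zones_def)
  show "acts_cocompactly X g (O_arc X x y I)" if "austro_boreal X g x y I" for x y I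
    using that by (intro zone_cocompact[OF X hom]) (auto simp: zones_def)
  show "\<Union> (components (K_set X g)) = K_set X g"
    by (rule Union_components)
  show "disjoint (components (K_set X g))"
    by (meson components_nonoverlap disjnt_def pairwiseI)
  fix Y assume Y: "Y \<in> components (K_set X g)"
  show "sub_dendrite X Y"
    by (rule component_K_set_sub_dendrite[OF X hom Y])
  show "g ` Y = Y"
    by (rule component_K_set_invariant[OF X hom Y])
  show "Fix X g \<inter> Y \<noteq> {}"
    using component_K_set_fixed_point[OF X hom Y] in_components_subset[OF Y] K_set_subset[OF X hom]
    by (force simp: Fix_def)
  show "connected (Fix X g \<inter> Y)"
    by (rule component_K_set_connected_Fix[OF X hom Y])
qed

end
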